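(* Let $X$ be a topological space and let $\phi: X\to \mathcal{M}$ be a continuous map. For each $x\in X$ let $I_x\subset \mathcal{P}_d$ be the two-sided graded ideal uniquely determined by the condition $\phi(x)=p_{I_x}$. Then there exists a bundle of Banach algebras $(E,X,\pi,\|\cdot\|)$ such that for every $x\in X$ the fiber $\pi^{-1}(x)$ is isomorphic, as a Banach algebra (isometrically), to $\mathcal{A}_d/\overline{I_x}$.
   Context: Fix a natural number $d\geq 1$; $\mathbb{C}^d$ has its standard inner product and orthonormal basis $e_1,\dots,e_d$. The full Fock space $\mathcal{F}(\mathbb{C}^d)$ is the Hilbert direct sum of $(\mathbb{C}^d)^{\otimes k}$, $k\geq 0$, with orthonormal basis the vectors $e_{i_1}\otimes\cdots\otimes e_{i_k}$ ($k\ge 0$). The creation operators $s_j\in\mathcal{B}(\mathcal{F}(\mathbb{C}^d))$ are the isometries $e_{i_1}\otimes\cdots\otimes e_{i_k}\mapsto e_j\otimes e_{i_1}\otimes\cdots\otimes e_{i_k}$. $\mathcal{P}_d$ is the unital algebra generated by $s_1,\dots,s_d$ (it is a free algebra on $s_1,\dots,s_d$), graded by $\mathcal{P}_d^k=\operatorname{span}\{s_{i_1}\cdots s_{i_k}\}$, and the noncommutative disk algebra $\mathcal{A}_d$ is the operator-norm closure of $\mathcal{P}_d$ in $\mathcal{B}(\mathcal{F}(\mathbb{C}^d))$. Graded ideals are two-sided ideals of the form $I=\bigoplus_{k\geq 1}I^k\subset\mathcal{P}_d$ with $I^k\subset \mathcal{P}_d^k$; $\overline{I}$ is the closure of $I$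 in $\mathcal{A}_d$ and $\mathcal{A}_d/\overline{I}$ has the quotient norm. Let $Ev:\mathcal{P}_d\to\mathcal{F}(\mathbb{C}^d)$ be the linear map $s_{i_1}\cdots s_{i_k}\mapsto e_{i_1}\otimes\cdots\otimes e_{i_k}$. For a graded ideal $I$, $p_I\in\mathcal{B}(\mathcal{F}(\mathbb{C}^d))$ is the orthogonal projection onto $Ev(I)^{\perp}$; $p_I$ determines $I$ uniquely. $\mathcal{M}\subset\mathcal{B}(\mathcal{F}(\mathbb{C}^d))$ is the set of all such operators $p_I$, with the topology induced from the strong operator topology. A bundle of locally convex algebras is a quadruple $(E,X,\pi,\mathcal{N})$ where $E,X$ are topological spaces, $\pi:E\to X$ is a continuous open surjection, each fiber $\pi^{-1}(x)$ carries the structure of an algebra, and $\mathcal{N}$ is a directed family of functions $\sigma:E\to\mathbb{R}_{\geq 0}$ restricting to a seminorm on each fiber (directed: for all $\sigma_1,\sigma_2\in\mathcal{N}$ there are $\sigma\in\mathcal{N}$, $C>0$ with $\sigma_1\le C\sigma$ and $\sigma_2\leq C\sigma$ on $E$), such that: (A1) $E\times_X E\to E$, $(e_1,e_2)\mapsto e_1+e_2$ is continuous; (A2) $E\times\mathbb{C}\to E$, $(e,\lambda)\mapsto\lambda e$ is continuous; (A3) $E\times_X E\to E$, $(e_1,e_2)\mapsto e_1e_2$ is continuous; (A4) for each $x\in X$, the sets $\{e\in E:\pi(e)\in U,\ \sigma(e)<\varepsilon\}$, with $U$ an open neighborhood of $x$, $\sigma\in\mathcal{N}$, $\varepsilon>0$,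 form a local base at the zero vector $0_x$ of $\pi^{-1}(x)$; (A5) every $\sigma\in\mathcal{N}$ is continuous on $E$. A bundle of Banach algebras $(E,X,\pi,\|\cdot\|)$ is such a bundle in which $\mathcal{N}=\{\|\cdot\|\}$ consists of a single function restricting to a norm on each fiber, making each fiber a Banach algebra. *)

theory Defs
  imports "HOL-Analysis.Analysis" "HOL-Algebra.QuotRing" "HOL-Algebra.Module"
begin

section \<open>The complex Hilbert space of square-summable families\<close>

typedef 'a ell2 = "{f :: 'a \<Rightarrow> complex. (\<lambda>i. (cmod (f i))\<^sup>2) summable_on UNIV}"
  morphisms coord Abs_ell2
  by (rule exI[of _ "\<lambda>_. 0"]) simp

setup_lifting type_definition_ell2

lemma sq_summable_add:
  fixes f g :: "'a \<Rightarrow> complex"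
  assumes "(\<lambda>i. (cmod (f i))\<^sup>2) summable_on UNIV" "(\<lambda>i. (cmod (g i))\<^sup>2) summable_on UNIV"
  shows "(\<lambda>i. (cmod (f i + g i))\<^sup>2) summable_on UNIV"
proof (rule summable_on_comparison_test)
  show "(\<lambda>i. 2 * (cmod (f i))\<^sup>2 + 2 * (cmod (g i))\<^sup>2) summable_on UNIV"
    by (intro summable_on_add summable_on_cmult_right assms)
  fix i
  have "(cmod (f i + g i))\<^sup>2 \<le> (cmod (f i) + cmod (g i))\<^sup>2"
    by (intro power_mono norm_triangle_ineq) auto
  also have "\<dots> \<le> 2 * (cmod (f i))\<^sup>2 + 2 * (cmod (g i))\<^sup>2"
    using sum_squares_bound[of "cmod (f i)" "cmod (g i)"] by (simp add: power2_sum)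
  finally show "(cmod (f i + g i))\<^sup>2 \<le> 2 * (cmod (f i))\<^sup>2 + 2 * (cmod (g i))\<^sup>2" .
qed auto

lemma sq_summable_prod:
  fixes f g :: "'a \<Rightarrow> complex"
  assumes "(\<lambda>i. (cmod (f i))\<^sup>2) summable_on UNIV" "(\<lambda>i. (cmod (g i))\<^sup>2) summable_on UNIV"
  shows "(\<lambda>i. cmod (f i) * cmod (g i)) summable_on UNIV"
proof (rule summable_on_comparison_test)
  show "(\<lambda>i. (cmod (f i))\<^sup>2 + (cmod (g i))\<^sup>2) summable_on UNIV"
    by (intro summable_on_add assms)
  fix i
  have "0 \<le> cmod (f i) * cmod (g i)" by simp
  then show "cmod (f i) * cmod (g i) \<le> (cmod (f i))\<^sup>2 + (cmod (g i))\<^sup>2"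
    using sum_squares_bound[of "cmod (f i)" "cmod (g i)"] by linarith
qed auto

lemma sq_summable_cmult:
  fixes f :: "'a \<Rightarrow> complex"
  assumes "(\<lambda>i. (cmod (f i))\<^sup>2) summable_on UNIV"
  shows "(\<lambda>i. (cmod (c * f i))\<^sup>2) summable_on UNIV"
  using summable_on_cmult_right[OF assms, of "(cmod c)\<^sup>2"]
  by (simp add: norm_mult power_mult_distrib)

lift_definition cscale :: "complex \<Rightarrow> 'a ell2 \<Rightarrow> 'a ell2" is "\<lambda>c f i. c * f i"
  by (rule sq_summable_cmult)

lift_definition cinner :: "'a ell2 \<Rightarrow> 'a ell2 \<Rightarrow> complex"
  is "\<lambda>f g. \<Sum>\<^sub>\<infinity>i. cnj (f i) * g i" .

lift_definition ket :: "'a \<Rightarrow> 'a ell2" is "\<lambda>i j. if j = i then 1 else 0"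
proof -
  fix i :: 'a
  show "(\<lambda>j. (cmod (if j = i then 1 else 0))\<^sup>2) summable_on UNIV"
    by (rule summable_on_cong_neutral[where T = "{i}", THEN iffD2]) auto
qed

instantiation ell2 :: (type) real_inner
begin

lift_definition zero_ell2 :: "'a ell2" is "\<lambda>_. 0" by simp
lift_definition plus_ell2 :: "'a ell2 \<Rightarrow> 'a ell2 \<Rightarrow> 'a ell2" is "\<lambda>f g i. f i + g i"
  by (rule sq_summable_add)
lift_definition uminus_ell2 :: "'a ell2 \<Rightarrow> 'a ell2" is "\<lambda>f i. - f i" by simp
lift_definition minus_ell2 :: "'a ell2 \<Rightarrow> 'a ell2 \<Rightarrow> 'a ell2" is "\<lambda>f g i. f i - g i"
  using sq_summable_add[of _ "\<lambda>i. - _ i"] by simp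
lift_definition scaleR_ell2 :: "real \<Rightarrow> 'a ell2 \<Rightarrow> 'a ell2" is "\<lambda>r f i. complex_of_real r * f i"
  by (rule sq_summable_cmult)
definition inner_ell2 :: "'a ell2 \<Rightarrow> 'a ell2 \<Rightarrow> real" where
  "inner_ell2 x y = Re (cinner x y)"
definition norm_ell2 :: "'a ell2 \<Rightarrow> real" where "norm_ell2 x = sqrt (inner x x)"
definition sgn_ell2 :: "'a ell2 \<Rightarrow> 'a ell2" where "sgn_ell2 x = inverse (norm x) *\<^sub>R x"
definition dist_ell2 :: "'a ell2 \<Rightarrow> 'a ell2 \<Rightarrow> real" where "dist_ell2 x y = norm (x - y)"
definition uniformity_ell2 :: "('a ell2 \<times> 'a ell2) filter" where
  "uniformity_ell2 = (INF e\<in>{0 <..}. principal {(x, y). dist x y < e})"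
definition open_ell2 :: "'a ell2 set \<Rightarrow> bool" where
  "open_ell2 U = (\<forall>x\<in>U. eventually (\<lambda>(x', y). x' = x \<longrightarrow> y \<in> U) uniformity)"

lemma coord_sq_summable: "(\<lambda>i. (cmod (coord x i))\<^sup>2) summable_on UNIV"
  using coord[of x] by simp

lemma cinner_summable: "(\<lambda>i. cnj (coord x i) * coord y i) summable_on UNIV"
  by (rule abs_summable_summable)
     (simp add: norm_mult sq_summable_prod[OF coord_sq_summable coord_sq_summable])

lemma inner_ell2_coord: "inner x y = (\<Sum>\<^sub>\<infinity>i. Re (cnj (coord x i) * coord y i))"
  by (simp only: inner_ell2_def cinner.rep_eq infsum_Re[OF cinner_summable])

lemma inner_ell2_self: "inner x x = (\<Sum>\<^sub>\<infinity>i. (cmod (coord x i))\<^sup>2)"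
  unfolding inner_ell2_coord
  by (rule infsum_cong) (simp add: cmod_power2, simp add: power2_eq_square)

instance
proof
  fix x y z :: "'a ell2" and r s :: real
  show "x + y + z = x + (y + z)" by transfer (simp add: add.assoc)
  show "x + y = y + x" by transfer (simp add: add.commute)
  show "0 + x = x" by transfer simp
  show "- x + x = 0" by transfer simp
  show "x - y = x + - y" by transfer simp
  show "r *\<^sub>R (x + y) = r *\<^sub>R x + r *\<^sub>R y" by transfer (simp add: algebra_simps)
  show "(r + s) *\<^sub>R x = r *\<^sub>R x + s *\<^sub>R x" by transfer (simp add: algebra_simps)
  show "r *\<^sub>R s *\<^sub>R x = (r * s) *\<^sub>R x" by transfer (simp add: algebra_simps)
  show "1 *\<^sub>R x = x" by transfer simp
  show "sgn x = inverse (norm x) *\<^sub>R x" by (rule sgn_ell2_def)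
  show "dist x y = norm (x - y)" by (rule dist_ell2_def)
  show "uniformity = (INF e\<in>{0 <..}. principal {(x :: 'a ell2, y). dist x y < e})"
    by (rule uniformity_ell2_def)
  show "open U = (\<forall>x\<in>U. eventually (\<lambda>(x', y). x' = x \<longrightarrow> y \<in> U) uniformity)" for U :: "'a ell2 set"
    by (rule open_ell2_def)
  show "norm x = sqrt (inner x x)" by (rule norm_ell2_def)
  have summ: "(\<lambda>i. Re (cnj (coord u i) * coord v i)) summable_on UNIV" for u v :: "'a ell2"
    by (intro summable_on_Re cinner_summable)
  show "inner x y = inner y x"
    unfolding inner_ell2_coord by (rule infsum_cong) (simp add: mult.commute)
  have "inner (x + y) z
      = (\<Sum>\<^sub>\<infinity>i. Re (cnj (coord x i) * coord z i) + Re (cnj (coord y i) * coord z i))"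
    unfolding inner_ell2_coord by (rule infsum_cong) (simp add: plus_ell2.rep_eq algebra_simps)
  then show "inner (x + y) z = inner x z + inner y z"
    unfolding inner_ell2_coord by (simp only: infsum_add[OF summ summ])
  have "inner (r *\<^sub>R x) y = (\<Sum>\<^sub>\<infinity>i. r * Re (cnj (coord x i) * coord y i))"
    unfolding inner_ell2_coord by (rule infsum_cong) (simp add: scaleR_ell2.rep_eq algebra_simps)
  then show "inner (r *\<^sub>R x) y = r * inner x y"
    unfolding inner_ell2_coord by (simp only: infsum_cmult_right')
  show "0 \<le> inner x x"
    unfolding inner_ell2_self by (rule infsum_nonneg) simp
  show "inner x x = 0 \<longleftrightarrow> x = 0"
  proof
    assume "inner x x = 0"
    then have "(cmod (coord x i))\<^sup>2 = 0" for i
      using nonneg_infsum_le_0D[OF _ coord_sq_summable[of x], of i]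
      by (simp add: inner_ell2_self)
    then show "x = 0"
      by (simp add: coord_inject[symmetric] zero_ell2.rep_eq fun_eq_iff)
  next
    assume "x = 0"
    then show "inner x x = 0" by (simp add: inner_ell2_self zero_ell2.rep_eq)
  qed
qed

end

lemma norm_ell2_sq: "(norm x)\<^sup>2 = (\<Sum>\<^sub>\<infinity>i. (cmod (coord x i))\<^sup>2)"
  by (simp only: inner_ell2_self[symmetric] power2_norm_eq_inner[of x])

lemma norm_ell2_sq_finite_le:
  assumes "finite A"
  shows "(\<Sum>i\<in>A. (cmod (coord x i))\<^sup>2) \<le> (norm x)\<^sup>2"
  unfolding norm_ell2_sq
  by (rule finite_sum_le_infsum[OF coord_sq_summable assms]) auto

lemma norm_coord_le: "cmod (coord x i) \<le> norm x"
proof (rule power2_le_imp_le)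
  show "(cmod (coord x i))\<^sup>2 \<le> (norm x)\<^sup>2"
    using norm_ell2_sq_finite_le[of "{i}" x] by simp
qed simp

instance ell2 :: (type) complete_space
proof
  fix S :: "nat \<Rightarrow> 'a ell2"
  assume S: "Cauchy S"
  have "Cauchy (\<lambda>n. coord (S n) i)" for i
  proof (rule metric_CauchyI)
    fix e :: real assume "0 < e"
    then obtain M where M: "\<And>m n. m \<ge> M \<Longrightarrow> n \<ge> M \<Longrightarrow> dist (S m) (S n) < e"
      using metric_CauchyD[OF S] by blast
    show "\<exists>M. \<forall>m\<ge>M. \<forall>n\<ge>M. dist (coord (S m) i) (coord (S n) i) < e"
    proof (intro exI allI impI)
      fix m n assume "m \<ge> M" "n \<ge> M"
      then show "dist (coord (S m) i) (coord (S n) i) < e"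
        using M[of m n] norm_coord_le[of "S m - S n" i]
        by (simp add: dist_norm minus_ell2.rep_eq)
    qed
  qed
  then have "\<exists>l. (\<lambda>n. coord (S n) i) \<longlonglongrightarrow> l" for i
    by (simp add: Cauchy_convergent_iff convergent_def)
  then obtain l where l: "\<And>i. (\<lambda>n. coord (S n) i) \<longlonglongrightarrow> l i" by metis
  have tail: "(\<Sum>i\<in>A. (cmod (coord (S n) i - l i))\<^sup>2) \<le> e\<^sup>2"
    if "finite A" "e > 0" "\<And>m. m \<ge> n \<Longrightarrow> dist (S m) (S n) < e" for A n e
  proof (rule tendsto_upperbound)
    show "(\<lambda>m. \<Sum>i\<in>A. (cmod (coord (S n) i - coord (S m) i))\<^sup>2)
        \<longlonglongrightarrow> (\<Sum>i\<in>A. (cmod (coord (S n) i - l i))\<^sup>2)"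
      by (intro tendsto_intros l)
    show "\<forall>\<^sub>F m in sequentially. (\<Sum>i\<in>A. (cmod (coord (S n) i - coord (S m) i))\<^sup>2) \<le> e\<^sup>2"
      unfolding eventually_sequentially
    proof (intro exI allI impI)
      fix m assume "m \<ge> n"
      have "(\<Sum>i\<in>A. (cmod (coord (S n) i - coord (S m) i))\<^sup>2) \<le> (norm (S n - S m))\<^sup>2"
        using norm_ell2_sq_finite_le[OF \<open>finite A\<close>, of "S n - S m"] by (simp add: minus_ell2.rep_eq)
      also have "\<dots> \<le> e\<^sup>2"
        using that(3)[OF \<open>m \<ge> n\<close>] by (intro power_mono) (auto simp: dist_norm norm_minus_commute)
      finally show "(\<Sum>i\<in>A. (cmod (coord (S n) i - coord (S m) i))\<^sup>2) \<le> e\<^sup>2" .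
    qed
  qed simp
  have diff_summable: "(\<lambda>i. (cmod (coord (S n) i - l i))\<^sup>2) summable_on UNIV"
    if "e > 0" "\<And>m. m \<ge> n \<Longrightarrow> dist (S m) (S n) < e" for n e
    by (rule nonneg_bdd_above_summable_on)
       (auto intro!: bdd_aboveI2[where M = "e\<^sup>2"] tail that)
  obtain n0 where n0: "\<And>m. m \<ge> n0 \<Longrightarrow> dist (S m) (S n0) < 1"
    using metric_CauchyD[OF S, of 1] by auto
  have "(\<lambda>i. (cmod (l i - coord (S n0) i + coord (S n0) i))\<^sup>2) summable_on UNIV"
    using diff_summable[OF _ n0] coord_sq_summable[of "S n0"]
    by (intro sq_summable_add) (auto simp: norm_minus_commute)
  then have "(\<lambda>i. (cmod (l i))\<^sup>2) summable_on UNIV" by simp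
  then have L: "coord (Abs_ell2 l) = l" by (simp add: Abs_ell2_inverse)
  have "S \<longlonglongrightarrow> Abs_ell2 l"
  proof (rule metric_LIMSEQ_I)
    fix e :: real assume "0 < e"
    then obtain M where M: "\<And>m n. m \<ge> M \<Longrightarrow> n \<ge> M \<Longrightarrow> dist (S m) (S n) < e / 2"
      using metric_CauchyD[OF S, of "e / 2"] by auto
    show "\<exists>M. \<forall>n\<ge>M. dist (S n) (Abs_ell2 l) < e"
    proof (intro exI allI impI)
      fix n assume "n \<ge> M"
      then have n: "\<And>m. m \<ge> n \<Longrightarrow> dist (S m) (S n) < e / 2" using M by simp
      have "(norm (S n - Abs_ell2 l))\<^sup>2 = (\<Sum>\<^sub>\<infinity>i. (cmod (coord (S n) i - l i))\<^sup>2)"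
        by (simp add: norm_ell2_sq minus_ell2.rep_eq L)
      also have "\<dots> \<le> (e / 2)\<^sup>2"
        using \<open>0 < e\<close> n by (intro infsum_le_finite_sums diff_summable[of "e / 2"] tail) auto
      finally have "norm (S n - Abs_ell2 l) \<le> e / 2"
        using \<open>0 < e\<close> by (simp add: power_mono_iff)
      then show "dist (S n) (Abs_ell2 l) < e" using \<open>0 < e\<close> by (simp add: dist_norm)
    qed
  qed
  then show "convergent S" by (auto simp: convergent_def)
qed

lemma cscale_simps:
  "cscale c (x + y) = cscale c x + cscale c y"
  "cscale (c + d) x = cscale c x + cscale d x"
  "cscale c (cscale d x) = cscale (c * d) x"
  "cscale 1 x = x"
  "cscale c (r *\<^sub>R x) = r *\<^sub>R cscale c x"
  by (transfer; simp add: algebra_simps fun_eq_iff)+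

lemma cscale_of_real: "cscale (complex_of_real r) x = r *\<^sub>R x"
  by transfer simp

lemma norm_cscale: "norm (cscale c x) = cmod c * norm x"
proof -
  have "(norm (cscale c x))\<^sup>2 = (cmod c * norm x)\<^sup>2"
    by (simp add: norm_ell2_sq cscale.rep_eq norm_mult power_mult_distrib infsum_cmult_right')
  then show ?thesis by (rule power2_eq_imp_eq) auto
qed

lemma cinner_ket: "cinner (ket i) x = coord x i"
proof -
  have "cinner (ket i) x = (\<Sum>\<^sub>\<infinity>j\<in>{i}. coord x j)"
    unfolding cinner.rep_eq by (rule infsum_cong_neutral) (auto simp: ket.rep_eq)
  then show ?thesis by simp
qed

definition orth_compl :: "'a ell2 set \<Rightarrow> 'a ell2 set" where
  "orth_compl T = {x. \<forall>y\<in>T. cinner y x = 0}"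


section \<open>The full Fock space and its creation operators\<close>

text \<open>The letters are the elements of the finite type \<open>'d\<close>, so that \<open>d = CARD('d) \<ge> 1\<close>, and
  the word \<open>[i\<^sub>1, \<dots>, i\<^sub>k]\<close> indexes the basis vector \<open>e\<^bsub>i\<^sub>1\<^esub> \<otimes> \<dots> \<otimes> e\<^bsub>i\<^sub>k\<^esub>\<close>.\<close>

type_synonym 'd fock = "'d list ell2"

text \<open>These operators are only required to be real-linear; the complex-linear ones among them form
  a norm-closed subset, which contains the creation operators and all operators built from
  them below. On complex-linear operators the norm is the usual operator norm.\<close>

type_synonym 'd fock_op = "'d fock \<Rightarrow>\<^sub>L 'd fock"

lemma bounded_linear_cscale: "bounded_linear (cscale c)"
  by (rule bounded_linear_intro[where K = "cmod c"])
     (auto simp: cscale_simps norm_cscale mult.commute)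

definition op_scale :: "complex \<Rightarrow> 'd fock_op \<Rightarrow> 'd fock_op" where
  "op_scale c A = Blinfun (\<lambda>x. cscale c (blinfun_apply A x))"

lemma op_scale_apply: "blinfun_apply (op_scale c A) x = cscale c (blinfun_apply A x)"
  unfolding op_scale_def
  by (subst bounded_linear_Blinfun_apply)
     (auto intro: bounded_linear_compose[OF bounded_linear_cscale] blinfun.bounded_linear_right)

global_interpretation ops: vector_space "op_scale :: complex \<Rightarrow> 'd fock_op \<Rightarrow> 'd fock_op"
  by standard
     (auto intro!: blinfun_eqI simp: op_scale_apply plus_blinfun.rep_eq cscale_simps)

lift_definition creation_vec :: "'d \<Rightarrow> 'd fock \<Rightarrow> 'd fock"
  is "\<lambda>j f w. case w of [] \<Rightarrow> 0 | i # v \<Rightarrow> if i = j then f v else 0"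
proof -
  fix j :: 'd and f :: "'d list \<Rightarrow> complex"
  let ?g = "\<lambda>w. (cmod (case w of [] \<Rightarrow> 0 | i # v \<Rightarrow> if i = j then f v else 0))\<^sup>2"
  assume "(\<lambda>i. (cmod (f i))\<^sup>2) summable_on UNIV"
  then have "?g summable_on range ((#) j)"
    by (subst summable_on_reindex) (auto simp: o_def inj_on_def)
  then show "?g summable_on UNIV"
    by (rule summable_on_cong_neutral[THEN iffD1, rotated -1]) (auto split: list.splits)
qed

lemma norm_creation_vec: "norm (creation_vec j x) = norm x"
proof -
  have "(norm (creation_vec j x))\<^sup>2
      = (\<Sum>\<^sub>\<infinity>w\<in>range ((#) j). (cmod (coord (creation_vec j x) w))\<^sup>2)"
    unfolding norm_ell2_sq
    by (rule infsum_cong_neutral) (auto simp: creation_vec.rep_eq split: list.splits)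
  also have "\<dots> = (norm x)\<^sup>2"
    unfolding norm_ell2_sq
    by (subst infsum_reindex) (auto simp: o_def inj_on_def creation_vec.rep_eq)
  finally show ?thesis by (rule power2_eq_imp_eq) auto
qed

lift_definition creation :: "'d \<Rightarrow> 'd fock_op" is creation_vec
proof (rule bounded_linear_intro[where K = 1])
  fix j :: 'd and x y :: "'d fock" and r :: real
  show "creation_vec j (x + y) = creation_vec j x + creation_vec j y"
    by transfer (auto simp: fun_eq_iff split: list.splits)
  show "creation_vec j (r *\<^sub>R x) = r *\<^sub>R creation_vec j x"
    by transfer (auto simp: fun_eq_iff split: list.splits)
  show "norm (creation_vec j x) \<le> norm x * 1"
    by (simp add: norm_creation_vec)
qed

lemma norm_creation_apply: "norm (blinfun_apply (creation j) x) = norm x"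
  by (simp add: creation.rep_eq norm_creation_vec)

lemma creation_ket: "blinfun_apply (creation j) (ket w) = ket (j # w)"
  unfolding creation.rep_eq by transfer (auto simp: fun_eq_iff split: list.splits)

lemma creation_cscale: "blinfun_apply (creation j) (cscale c x) = cscale c (blinfun_apply (creation j) x)"
  unfolding creation.rep_eq by transfer (auto simp: fun_eq_iff split: list.splits)

definition monomial :: "'d list \<Rightarrow> 'd fock_op" where
  "monomial w = foldr (\<lambda>j A. creation j o\<^sub>L A) w id_blinfun"

lemma monomial_simps:
  "monomial [] = id_blinfun" "monomial (j # w) = creation j o\<^sub>L monomial w"
  by (simp_all add: monomial_def)

inductive_set nc_polys :: "'d::finite fock_op set" where
  one: "id_blinfun \<in> nc_polys"
| gen: "creation j \<in> nc_polys"
| add: "a \<in> nc_polys \<Longrightarrow> b \<in> nc_polys \<Longrightarrow> a + b \<in> nc_polys"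
| scale: "a \<in> nc_polys \<Longrightarrow> op_scale c a \<in> nc_polys"
| mult: "a \<in> nc_polys \<Longrightarrow> b \<in> nc_polys \<Longrightarrow> a o\<^sub>L b \<in> nc_polys"

definition homogeneous :: "nat \<Rightarrow> 'd::finite fock_op set" where
  "homogeneous k = ops.span (monomial ` {w. length w = k})"

definition nc_disk :: "'d::finite fock_op set" where
  "nc_disk = closure nc_polys"


section \<open>Complex algebras, quotients and norms\<close>

definition complex_ring :: "complex ring" where
  "complex_ring = \<lparr>carrier = UNIV, mult = (*), one = 1, zero = 0, add = (+)\<rparr>"

locale complex_algebra = module complex_ring A + ring A for A :: "(complex, 'a) module" (structure) +
  assumes smult_mult_left:
      "x \<in> carrier A \<Longrightarrow> y \<in> carrier A \<Longrightarrow> (c \<odot> x) \<otimes> y = c \<odot> (x \<otimes> y)"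
    and smult_mult_right:
      "x \<in> carrier A \<Longrightarrow> y \<in> carrier A \<Longrightarrow> x \<otimes> (c \<odot> y) = c \<odot> (x \<otimes> y)"

definition op_algebra :: "'d fock_op set \<Rightarrow> (complex, 'd fock_op) module" where
  "op_algebra S = \<lparr>carrier = S, mult = (o\<^sub>L), one = id_blinfun, zero = 0, add = (+),
     smult = op_scale\<rparr>"

definition quot_algebra :: "(complex, 'a) module \<Rightarrow> 'a set \<Rightarrow> (complex, 'a set) module" where
  "quot_algebra A J = ring.extend (A Quot J)
     (module.fields (\<lambda>c Y. \<Union>a\<in>Y. J +>\<^bsub>A\<^esub> (c \<odot>\<^bsub>A\<^esub> a)))"

text \<open>A coset is the set of its representatives, so for \<open>Y = a + J\<close> this is
  \<open>inf {norm (a + b) | b \<in> J}\<close>.\<close>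

definition quot_norm :: "'a::real_normed_vector set \<Rightarrow> real" where
  "quot_norm Y = (INF a\<in>Y. norm a)"

definition seminorm_on :: "(complex, 'a) module \<Rightarrow> ('a \<Rightarrow> real) \<Rightarrow> bool" where
  "seminorm_on A \<sigma> \<longleftrightarrow>
     (\<forall>a\<in>carrier A. 0 \<le> \<sigma> a) \<and>
     (\<forall>a\<in>carrier A. \<forall>b\<in>carrier A. \<sigma> (a \<oplus>\<^bsub>A\<^esub> b) \<le> \<sigma> a + \<sigma> b) \<and>
     (\<forall>c. \<forall>a\<in>carrier A. \<sigma> (c \<odot>\<^bsub>A\<^esub> a) = cmod c * \<sigma> a)"

definition complete_norm_on :: "(complex, 'a) module \<Rightarrow> ('a \<Rightarrow> real) \<Rightarrow> bool" where
  "complete_norm_on A \<nu> \<longleftrightarrow>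
     (\<forall>u :: nat \<Rightarrow> 'a. range u \<subseteq> carrier A \<and>
        (\<forall>\<epsilon>>0. \<exists>N. \<forall>m\<ge>N. \<forall>n\<ge>N. \<nu> (u m \<ominus>\<^bsub>A\<^esub> u n) < \<epsilon>) \<longrightarrow>
        (\<exists>l\<in>carrier A. (\<lambda>n. \<nu> (u n \<ominus>\<^bsub>A\<^esub> l)) \<longlonglongrightarrow> 0))"

definition banach_algebra :: "(complex, 'a) module \<Rightarrow> ('a \<Rightarrow> real) \<Rightarrow> bool" where
  "banach_algebra A \<nu> \<longleftrightarrow> complex_algebra A \<and> seminorm_on A \<nu> \<and>
     (\<forall>a\<in>carrier A. \<nu> a = 0 \<longrightarrow> a = \<zero>\<^bsub>A\<^esub>) \<and>
     (\<forall>a\<in>carrier A. \<forall>b\<in>carrier A. \<nu> (a \<otimes>\<^bsub>A\<^esub> b) \<le> \<nu> a * \<nu> b) \<and>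
     complete_norm_on A \<nu>"

definition isometric_iso ::
  "(complex, 'a) module \<Rightarrow> ('a \<Rightarrow> real) \<Rightarrow> (complex, 'b) module \<Rightarrow> ('b \<Rightarrow> real) \<Rightarrow> ('a \<Rightarrow> 'b) \<Rightarrow> bool"
  where "isometric_iso A \<mu> B \<nu> h \<longleftrightarrow> h \<in> ring_iso A B \<and>
     (\<forall>c. \<forall>a\<in>carrier A. h (c \<odot>\<^bsub>A\<^esub> a) = c \<odot>\<^bsub>B\<^esub> h a) \<and>
     (\<forall>a\<in>carrier A. \<nu> (h a) = \<mu> a)"


section \<open>Graded ideals and their projections\<close>

text \<open>The subspaces \<open>homogeneous k\<close> are linearly independent, hence the sum of the \<open>J k\<close> is
  direct.\<close>

definition graded_ideal :: "'d::finite fock_op set \<Rightarrow> bool" where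
  "graded_ideal I \<longleftrightarrow> ideal I (op_algebra nc_polys) \<and>
     (\<exists>J. (\<forall>k\<ge>1. ops.subspace (J k) \<and> J k \<subseteq> homogeneous k) \<and> I = ops.span (\<Union>k\<in>{1..}. J k))"

definition disk_quotient :: "'d::finite fock_op set \<Rightarrow> (complex, 'd fock_op set) module" where
  "disk_quotient I = quot_algebra (op_algebra nc_disk) (closure I)"

text \<open>The vacuum is \<open>ket []\<close>. Evaluation there is linear and sends \<open>monomial w\<close> to \<open>ket w\<close>, which
  determines the map on the span of the monomials.\<close>

definition Ev :: "'d fock_op \<Rightarrow> 'd fock" where
  "Ev a = blinfun_apply a (ket [])"

lemma Ev_monomial: "Ev (monomial w) = ket w"
  by (induction w) (simp_all add: Ev_def monomial_simps creation_ket)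

lemma Ev_linear: "Ev (a + b) = Ev a + Ev b" "Ev (op_scale c a) = cscale c (Ev a)"
  by (simp_all add: Ev_def plus_blinfun.rep_eq op_scale_apply)

lemma creation_comp_linear:
  "creation j o\<^sub>L (a + b) = (creation j o\<^sub>L a) + (creation j o\<^sub>L b)"
  "creation j o\<^sub>L op_scale c a = op_scale c (creation j o\<^sub>L a)"
  by (auto intro!: blinfun_eqI
      simp: plus_blinfun.rep_eq op_scale_apply creation_cscale blinfun.add_right)

lemma nc_polys_eq_span: "(nc_polys :: 'd::finite fock_op set) = ops.span (range monomial)"
proof
  let ?V = "ops.span (range (monomial :: 'd list \<Rightarrow> 'd fock_op))"
  have app: "monomial v o\<^sub>L monomial w = monomial (v @ w)" for v w :: "'d list"
    by (induction v) (auto simp: monomial_simps blinfun_apply_inject[symmetric] fun_eq_iff)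
  have lin: "monomial v o\<^sub>L op_scale c a = op_scale c (monomial v o\<^sub>L a)"
    for v :: "'d list" and c a
    by (induction v) (auto simp: monomial_simps op_scale_apply blinfun_apply_inject[symmetric] fun_eq_iff creation_cscale)
  have left: "monomial v o\<^sub>L b \<in> ?V" if "b \<in> ?V" for v b
    using that
  proof (induction rule: ops.span_induct_alt)
    case base
    show ?case using ops.span_zero by (simp add: blinfun_compose_zero)
  next
    case (step c x y)
    then obtain w where "x = monomial w" by auto
    moreover have "monomial v o\<^sub>L (op_scale c x + y) = op_scale c (monomial v o\<^sub>L x) + (monomial v o\<^sub>L y)"
      by (simp add: lin[symmetric] bounded_bilinear.add_right[OF bounded_bilinear_blinfun_compose])
    ultimately show ?case
      using step by (auto simp: app intro!: ops.span_add ops.span_scale intro: ops.span_base)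
  qed
  have mult: "a o\<^sub>L b \<in> ?V" if "a \<in> ?V" "b \<in> ?V" for a b
    using that(1)
  proof (induction rule: ops.span_induct_alt)
    case base
    show ?case using ops.span_zero by (simp add: blinfun_compose_zero)
  next
    case (step c x y)
    have "(op_scale c x + y) o\<^sub>L b = op_scale c (x o\<^sub>L b) + (y o\<^sub>L b)"
      by (auto intro!: blinfun_eqI simp: plus_blinfun.rep_eq op_scale_apply)
    then show ?case using step left[OF that(2)] by (auto intro!: ops.span_add ops.span_scale)
  qed
  have "a \<in> ?V" if "a \<in> nc_polys" for a
    using that
  proof induction
    case one
    have "id_blinfun = (monomial [] :: 'd fock_op)" by (simp add: monomial_simps)
    then show ?case by (metis ops.span_base rangeI)
  next
    case (gen j)
    have "creation j = monomial [j]" by (auto intro!: blinfun_eqI simp: monomial_simps)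
    then show ?case by (metis ops.span_base rangeI)
  qed (auto intro: ops.span_add ops.span_scale mult)
  then show "nc_polys \<subseteq> ?V" by blast
  have "monomial w \<in> nc_polys" for w :: "'d list"
    by (induction w) (auto simp: monomial_simps intro: nc_polys.intros)
  moreover have "ops.subspace (nc_polys :: 'd fock_op set)"
    using nc_polys.scale[OF nc_polys.one, of 0]
    by (auto simp: ops.subspace_def intro: nc_polys.intros)
  ultimately show "?V \<subseteq> nc_polys" by (intro ops.span_minimal) auto
qed

definition orth_projection_onto :: "'d fock set \<Rightarrow> 'd fock_op \<Rightarrow> bool" where
  "orth_projection_onto S P \<longleftrightarrow>
     (\<forall>x. blinfun_apply P x \<in> S \<and> x - blinfun_apply P x \<in> orth_compl S)"

definition ideal_projection :: "'d::finite fock_op set \<Rightarrow> 'd fock_op \<Rightarrow> bool" where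
  "ideal_projection I P \<longleftrightarrow> orth_projection_onto (orth_compl (Ev ` I)) P"

definition ideal_projections :: "'d::finite fock_op set" where
  "ideal_projections = {P. \<exists>I. graded_ideal I \<and> ideal_projection I P}"

definition ideal_space :: "'d::finite fock_op topology" where
  "ideal_space = subtopology strong_operator_topology ideal_projections"


section \<open>Bundles of algebras\<close>

text \<open>\<open>F x\<close> is the algebra structure on the fiber over \<open>x\<close>.\<close>

locale lc_algebra_bundle =
  fixes E :: "'e topology" and X :: "'x topology" and \<pi> :: "'e \<Rightarrow> 'x"
    and F :: "'x \<Rightarrow> (complex, 'e) module" and \<N> :: "('e \<Rightarrow> real) set"
  assumes proj_continuous: "continuous_map E X \<pi>"
    and proj_open: "open_map E X \<pi>"
    and proj_surj: "\<pi> ` topspace E = topspace X"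
    and fiber_carrier: "x \<in> topspace X \<Longrightarrow> carrier (F x) = {e \<in> topspace E. \<pi> e = x}"
    and fiber_algebra: "x \<in> topspace X \<Longrightarrow> complex_algebra (F x)"
    and fiber_seminorm: "\<sigma> \<in> \<N> \<Longrightarrow> x \<in> topspace X \<Longrightarrow> seminorm_on (F x) \<sigma>"
    and directed: "\<sigma>\<^sub>1 \<in> \<N> \<Longrightarrow> \<sigma>\<^sub>2 \<in> \<N> \<Longrightarrow>
      \<exists>\<sigma>\<in>\<N>. \<exists>C>0. \<forall>e\<in>topspace E. \<sigma>\<^sub>1 e \<le> C * \<sigma> e \<and> \<sigma>\<^sub>2 e \<le> C * \<sigma> e"
    and add_continuous:
      "continuous_map (subtopology (prod_topology E E) {(e, e'). \<pi> e = \<pi> e'}) E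
         (\<lambda>(e, e'). e \<oplus>\<^bsub>F (\<pi> e)\<^esub> e')"
    and smult_continuous:
      "continuous_map (prod_topology E euclidean) E (\<lambda>(e, c). c \<odot>\<^bsub>F (\<pi> e)\<^esub> e)"
    and mult_continuous:
      "continuous_map (subtopology (prod_topology E E) {(e, e'). \<pi> e = \<pi> e'}) E
         (\<lambda>(e, e'). e \<otimes>\<^bsub>F (\<pi> e)\<^esub> e')"
    and tube_nbhd: "openin X U \<Longrightarrow> x \<in> U \<Longrightarrow> \<sigma> \<in> \<N> \<Longrightarrow> 0 < \<epsilon> \<Longrightarrow>
      openin E {e \<in> topspace E. \<pi> e \<in> U \<and> \<sigma> e < \<epsilon>} \<and>
      \<zero>\<^bsub>F x\<^esub> \<in> {e \<in> topspace E. \<pi> e \<in> U \<and> \<sigma> e < \<epsilon>}"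
    and tube_base: "x \<in> topspace X \<Longrightarrow> openin E W \<Longrightarrow> \<zero>\<^bsub>F x\<^esub> \<in> W \<Longrightarrow>
      \<exists>U \<sigma> \<epsilon>. openin X U \<and> x \<in> U \<and> \<sigma> \<in> \<N> \<and> 0 < \<epsilon> \<and>
        {e \<in> topspace E. \<pi> e \<in> U \<and> \<sigma> e < \<epsilon>} \<subseteq> W"
    and seminorm_continuous: "\<sigma> \<in> \<N> \<Longrightarrow> continuous_map E euclideanreal \<sigma>"

locale banach_algebra_bundle = lc_algebra_bundle E X \<pi> F "{\<nu>}"
  for E :: "'e topology" and X :: "'x topology" and \<pi> :: "'e \<Rightarrow> 'x"
    and F :: "'x \<Rightarrow> (complex, 'e) module" and \<nu> :: "'e \<Rightarrow> real" +
  assumes fiber_banach: "x \<in> topspace X \<Longrightarrow> banach_algebra (F x) \<nu>"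

end

theory Submission
  imports Defs
begin

text \<open>The total space is the set of pairs of a point \<open>x\<close> and a coset of \<open>closure (I x)\<close> in the
  disk algebra, with the quotient topology of \<open>X \<times> nc_disk\<close>. For this topology to give a bundle of
  Banach algebras it suffices that, for each fixed \<open>a\<close>, the quotient norm
  \<open>infdist a (closure (I x))\<close> is a continuous function of \<open>x\<close>. Upper semicontinuity makes the
  quotient map open (\<open>open_map_total_class\<close>): an element of one ideal is almost an element of the
  nearby ideals, so that representatives can be moved between neighbouring fibers. An open
  quotient map transports the continuity of the operations on \<open>X \<times> nc_disk\<close> to the total space,
  and continuity of the distance is exactly continuity of the norm.

  The analytic point is therefore the continuity of the distance, \<open>infdist_ideal_continuous\<close>. In
  bounded degree everything is finite-dimensional: by \<open>weighted_poly_residual_in_ideal\<close> the low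
  degree part of \<open>\<xi> - P \<xi>\<close> is the image under \<open>Ev\<close> of an element of the ideal of \<open>P\<close>, so an
  element of degree less than \<open>N\<close> of one ideal is close to an element of another one as soon as
  the two projections are close on the finitely many basis vectors of degree less than \<open>N\<close>, and
  this is controlled by the strong operator topology. The error is proportional to the norm of
  that element. What remains is to bound the degree of the best approximant in the ideal,
  uniformly in the ideal. Fejer means do this: they are averages of the gauge automorphisms
  \<open>s\<^sub>j \<mapsto> z s\<^sub>j\<close> and hence contractive (\<open>norm_fejer_mean_le\<close>), they act on each homogeneous
  component by a scalar and hence preserve every graded ideal (\<open>graded_ideal_weighted_poly\<close>), they
  cut off the degree, and they converge to the identity on polynomials. Replacing both the given
  polynomial and its approximant by their Fejer means thus costs little, and
  \<open>infdist_ideal_compare\<close> follows.\<close>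

section \<open>Complex scalars and the disk algebra\<close>

lemma norm_op_scale: "norm (op_scale c a) = cmod c * norm a"
proof -
  have le: "norm (op_scale c a) \<le> cmod c * norm a" for c and a :: "'d fock_op"
    by (rule norm_blinfun_bound)
       (auto simp: op_scale_apply norm_cscale mult.assoc intro!: mult_left_mono norm_blinfun)
  show ?thesis
  proof (cases "c = 0")
    case False
    then have "norm a = norm (op_scale (inverse c) (op_scale c a))" by simp
    also have "\<dots> \<le> cmod (inverse c) * norm (op_scale c a)" by (rule le)
    finally have "cmod c * norm a \<le> cmod c * (cmod (inverse c) * norm (op_scale c a))"
      by (rule mult_left_mono) simp
    then have "cmod c * norm a \<le> norm (op_scale c a)"
      using False by (simp add: norm_inverse mult.assoc[symmetric])
    then show ?thesis using le[of c a] by simp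
  qed simp
qed

lemma op_scale_of_real: "op_scale (complex_of_real r) a = r *\<^sub>R a"
  by (auto intro!: blinfun_eqI simp: op_scale_apply cscale_of_real scaleR_blinfun.rep_eq)

lemma bounded_bilinear_op_scale: "bounded_bilinear (op_scale :: complex \<Rightarrow> 'd fock_op \<Rightarrow> 'd fock_op)"
proof
  fix c c' :: complex and a b :: "'d fock_op" and r :: real
  show "op_scale (c + c') a = op_scale c a + op_scale c' a" by (rule ops.scale_left_distrib)
  show "op_scale c (a + b) = op_scale c a + op_scale c b" by (rule ops.scale_right_distrib)
  show "op_scale (r *\<^sub>R c) a = r *\<^sub>R op_scale c a"
    by (simp add: op_scale_of_real[symmetric] scaleR_conv_of_real)
  show "op_scale c (r *\<^sub>R a) = r *\<^sub>R op_scale c a"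
    by (simp add: op_scale_of_real[symmetric] mult.commute)
  show "\<exists>K. \<forall>c (a :: 'd fock_op). norm (op_scale c a) \<le> norm c * norm a * K"
    by (rule exI[of _ 1]) (simp add: norm_op_scale)
qed

lemma op_scale_compose_left: "op_scale c a o\<^sub>L b = op_scale c (a o\<^sub>L b)"
  by (auto intro!: blinfun_eqI simp: op_scale_apply)

lemma blinfun_compose_assoc: "(a o\<^sub>L b) o\<^sub>L c = a o\<^sub>L (b o\<^sub>L c)"
  by (auto intro!: blinfun_eqI)

lemma blinfun_compose_distrib: "(a + b) o\<^sub>L c = (a o\<^sub>L c) + (b o\<^sub>L c)" "a o\<^sub>L (b + c) = (a o\<^sub>L b) + (a o\<^sub>L c)"
  by (auto intro!: blinfun_eqI simp: plus_blinfun.rep_eq blinfun.add_right)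

text \<open>Algebraic closure properties of \<open>nc_disk\<close> and of closures of ideals come from those of the
  dense subsets by continuity of the operations.\<close>

lemma closure_binop:
  fixes f :: "'a::topological_space \<Rightarrow> 'b::topological_space \<Rightarrow> 'c::topological_space"
  assumes f: "continuous_on UNIV (\<lambda>p. f (fst p) (snd p))"
    and ST: "\<And>x y. x \<in> S \<Longrightarrow> y \<in> T \<Longrightarrow> f x y \<in> C" and C: "closed C"
    and xy: "x \<in> closure S" "y \<in> closure T"
  shows "f x y \<in> C"
proof -
  have "(\<lambda>p. f (fst p) (snd p)) ` closure (S \<times> T) \<subseteq> C"
    by (rule image_closure_subset) (use ST C in \<open>auto intro: continuous_on_subset[OF f]\<close>)
  then show ?thesis using xy by (force simp: closure_Times)
qed

lemma continuous_on_plus_pair: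
  "continuous_on UNIV (\<lambda>p :: 'a::topological_monoid_add \<times> 'a. fst p + snd p)"
  by (intro continuous_intros)

lemma continuous_on_compose_pair:
  "continuous_on UNIV (\<lambda>p :: ('b::real_normed_vector \<Rightarrow>\<^sub>L 'c::real_normed_vector) \<times>
     ('a::real_normed_vector \<Rightarrow>\<^sub>L 'b). fst p o\<^sub>L snd p)"
  by (intro bounded_bilinear.continuous_on[OF bounded_bilinear_blinfun_compose] continuous_intros)

lemma nc_polys_subset_nc_disk: "nc_polys \<subseteq> nc_disk"
  by (simp add: nc_disk_def closure_subset)

lemma subspace_nc_polys: "ops.subspace (nc_polys :: 'd::finite fock_op set)"
  by (simp add: nc_polys_eq_span)

lemma nc_disk_closed_under:
  fixes a b :: "'d::finite fock_op"
  shows one_in_nc_disk: "id_blinfun \<in> (nc_disk :: 'd fock_op set)"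
    and zero_in_nc_disk: "0 \<in> (nc_disk :: 'd fock_op set)"
    and add_in_nc_disk: "a \<in> nc_disk \<Longrightarrow> b \<in> nc_disk \<Longrightarrow> a + b \<in> nc_disk"
    and mult_in_nc_disk: "a \<in> nc_disk \<Longrightarrow> b \<in> nc_disk \<Longrightarrow> a o\<^sub>L b \<in> nc_disk"
    and scale_in_nc_disk: "a \<in> nc_disk \<Longrightarrow> op_scale c a \<in> nc_disk"
proof -
  note sub = nc_polys_subset_nc_disk
  show "id_blinfun \<in> (nc_disk :: 'd fock_op set)" using sub nc_polys.one by blast
  show "0 \<in> (nc_disk :: 'd fock_op set)"
    using sub ops.subspace_0[OF subspace_nc_polys] by blast
  show "a + b \<in> nc_disk" if "a \<in> nc_disk" "b \<in> nc_disk"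
    using that unfolding nc_disk_def
    by (rule closure_binop[OF continuous_on_plus_pair _ closed_closure, rotated])
       (use closure_subset nc_polys.add in blast)
  show "a o\<^sub>L b \<in> nc_disk" if "a \<in> nc_disk" "b \<in> nc_disk"
    using that unfolding nc_disk_def
    by (rule closure_binop[OF continuous_on_compose_pair _ closed_closure, rotated])
       (use closure_subset nc_polys.mult in blast)
  show "op_scale c a \<in> nc_disk" if "a \<in> nc_disk"
  proof -
    have "op_scale c ` closure nc_polys \<subseteq> closure nc_polys"
      by (rule image_closure_subset)
         (use closure_subset nc_polys.scale in \<open>auto intro!: linear_continuous_on
            bounded_bilinear.bounded_linear_right[OF bounded_bilinear_op_scale]\<close>)
    then show ?thesis using that unfolding nc_disk_def by blast
  qed
qed

lemma nc_disk_uminus_diff: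
  fixes a b :: "'d::finite fock_op"
  shows uminus_in_nc_disk: "a \<in> nc_disk \<Longrightarrow> - a \<in> nc_disk"
    and diff_in_nc_disk: "a \<in> nc_disk \<Longrightarrow> b \<in> nc_disk \<Longrightarrow> a - b \<in> nc_disk"
proof -
  show *: "- a \<in> nc_disk" if "a \<in> nc_disk" for a :: "'d fock_op"
    using scale_in_nc_disk[OF that, of "-1"] by simp
  show "a - b \<in> nc_disk" if "a \<in> nc_disk" "b \<in> nc_disk"
    using add_in_nc_disk[OF that(1) *[OF that(2)]] by simp
qed

text \<open>Operators on Fock space are only real-linear in general; those in the disk algebra commute
  with complex scalars because the generators do and the condition is closed. This is what makes
  \<open>nc_disk\<close> a complex algebra.\<close>

lemma nc_disk_compose_scale:
  fixes a b :: "'d::finite fock_op"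
  assumes "a \<in> nc_disk"
  shows "a o\<^sub>L op_scale c b = op_scale c (a o\<^sub>L b)"
proof -
  let ?C = "{a. a o\<^sub>L op_scale c b = op_scale c (a o\<^sub>L b)}"
  have poly: "a \<in> ?C" if "a \<in> nc_polys" for a :: "'d fock_op"
    using that
  proof (induction arbitrary: b rule: nc_polys.induct)
    case one
    show ?case by (auto intro!: blinfun_eqI simp: op_scale_apply)
  next
    case (gen j)
    then show ?case by (simp add: creation_comp_linear)
  next
    case (mult a a')
    then have "a o\<^sub>L (a' o\<^sub>L op_scale c b) = op_scale c (a o\<^sub>L (a' o\<^sub>L b))" by simp
    then show ?case by (simp add: blinfun_compose_assoc)
  qed (auto simp: op_scale_compose_left blinfun_compose_distrib mult.commute
         ops.scale_right_distrib)
  have "closed ?C"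
    by (intro closed_Collect_eq bounded_bilinear.continuous_on[OF bounded_bilinear_op_scale]
        bounded_bilinear.continuous_on[OF bounded_bilinear_blinfun_compose] continuous_intros)
  then show ?thesis
    using assms poly closure_minimal[of nc_polys ?C] unfolding nc_disk_def by blast
qed

section \<open>The inner product and orthogonal approximation\<close>

lemma cinner_add_right: "cinner x (y + z) = cinner x y + cinner x z"
  unfolding cinner.rep_eq plus_ell2.rep_eq distrib_left
  by (rule infsum_add) (rule cinner_summable)+

lemma cinner_cscale_right: "cinner x (cscale c y) = c * cinner x y"
  unfolding cinner.rep_eq cscale.rep_eq
  by (simp add: mult.left_commute[of _ c] infsum_cmult_right')

lemma cinner_commute: "cinner y x = cnj (cinner x y)"
  unfolding cinner.rep_eq by (simp add: infsum_cnj[symmetric] mult.commute)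

lemma cscale_minus_one: "cscale (-1) x = - x"
  by transfer simp

lemma cinner_diff_right: "cinner x (y - z) = cinner x y - cinner x z"
  using cinner_add_right[of x y "cscale (-1) z"] cinner_cscale_right[of x "-1" z]
  by (simp add: cscale_minus_one)

lemma cinner_add_left: "cinner (x + y) z = cinner x z + cinner y z"
  using cinner_commute cinner_add_right by (metis complex_cnj_add)

lemma cinner_cscale_left: "cinner (cscale c x) y = cnj c * cinner x y"
  using cinner_commute cinner_cscale_right by (metis complex_cnj_mult)

lemma cinner_eq_zero: "cinner x x = 0 \<Longrightarrow> x = 0"
  using inner_eq_zero_iff[of x] by (simp add: inner_ell2_def)

lemma cinner_zero_left: "cinner 0 y = 0"
  using cinner_cscale_left[of 0 0 y] by (simp add: cinner.rep_eq zero_ell2.rep_eq)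

lemma Ev_zero: "Ev 0 = 0" and Ev_diff: "Ev (a - b) = Ev a - Ev b"
  and Ev_sum: "Ev (\<Sum>i\<in>S. g i) = (\<Sum>i\<in>S. Ev (g i))"
  by (simp_all add: Ev_def minus_blinfun.rep_eq blinfun.sum_left)

text \<open>Gram-Schmidt in disguise: \<open>Ev v\<close> is the orthogonal projection of \<open>\<xi>\<close> onto the
  finite-dimensional space \<open>Ev ` ops.span B\<close>. The induction orthogonalizes the new element against
  the old span and then subtracts from the residual of \<open>\<xi>\<close> its component along the result.\<close>

lemma finite_span_best_approximation:
  fixes B :: "'d fock_op set"
  assumes "finite B"
  shows "\<exists>v\<in>ops.span B. \<forall>b\<in>ops.span B. cinner (Ev b) (\<xi> - Ev v) = 0"
  using assms
proof (induction B arbitrary: \<xi> rule: finite_induct)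
  case empty
  then show ?case by (auto simp: Ev_zero cinner_zero_left)
next
  case (insert b B)
  obtain v0 where v0: "v0 \<in> ops.span B" "\<And>y. y \<in> ops.span B \<Longrightarrow> cinner (Ev y) (Ev b - Ev v0) = 0"
    using insert.IH[of "Ev b"] by blast
  obtain v1 where v1: "v1 \<in> ops.span B" "\<And>y. y \<in> ops.span B \<Longrightarrow> cinner (Ev y) (\<xi> - Ev v1) = 0"
    using insert.IH[of \<xi>] by blast
  define c where "c = b - v0"
  have c_orth: "cinner (Ev y) (Ev c) = 0" if "y \<in> ops.span B" for y
    using v0(2)[OF that] by (simp add: c_def Ev_diff)
  \<comment> \<open>If \<open>Ev c = 0\<close> then \<open>t = 0\<close> by division by zero, which is still the right coefficient.\<close>
  define t where "t = cinner (Ev c) (\<xi> - Ev v1) / cinner (Ev c) (Ev c)"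
  define v where "v = v1 + op_scale t c"
  have sub: "ops.span B \<subseteq> ops.span (insert b B)" by (intro ops.span_mono) auto
  have "c \<in> ops.span (insert b B)"
    unfolding c_def using v0 sub by (auto intro: ops.span_diff ops.span_base)
  then have "v \<in> ops.span (insert b B)"
    unfolding v_def using v1 sub by (auto intro: ops.span_add ops.span_scale)
  moreover have "cinner (Ev x) (\<xi> - Ev v) = 0" if x_in: "x \<in> ops.span (insert b B)" for x
  proof -
    obtain k where k: "x - op_scale k b \<in> ops.span B" using x_in ops.span_breakdown_eq[of x b B] by blast
    define y where "y = x - op_scale k b + op_scale k v0"
    have y: "y \<in> ops.span B" unfolding y_def using k v0 by (auto intro: ops.span_add ops.span_scale)
    have x: "x = op_scale k c + y" by (simp add: y_def c_def ops.scale_right_diff_distrib)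
    have r: "\<xi> - Ev v = (\<xi> - Ev v1) - cscale t (Ev c)" by (simp add: v_def Ev_linear)
    have "cinner (Ev c) (\<xi> - Ev v) = 0"
      unfolding r by (cases "Ev c = 0")
        (auto simp: cinner_diff_right[of _ "_ - _"] cinner_cscale_right t_def cinner_zero_left dest: cinner_eq_zero)
    moreover have "cinner (Ev y) (\<xi> - Ev v) = 0"
      unfolding r by (simp add: cinner_diff_right[of _ "_ - _"] cinner_cscale_right c_orth[OF y] v1(2)[OF y])
    ultimately show ?thesis by (simp add: x Ev_linear cinner_add_left cinner_cscale_left)
  qed
  ultimately show ?case by blast
qed

section \<open>Polynomials and their coefficients\<close>

definition words :: "nat \<Rightarrow> 'd list set" where "words N = {w. length w < N}"

lemma finite_words: "finite (words N :: 'd::finite list set)"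
  unfolding words_def by (rule finite_subset[OF _ finite_lists_length_le[of UNIV N]]) auto

text \<open>One operation serves three purposes. With \<open>c = (\<lambda>_. 1)\<close> it truncates a vector to degrees
  less than \<open>N\<close> and turns it into a polynomial, inverting \<open>Ev\<close> on the polynomials of such degree.
  Composed with \<open>Ev\<close>, on these polynomials, the choice \<open>c k = z ^ k\<close> gives the gauge action, and
  the Fejer coefficients give the Fejer means.\<close>

definition weighted_poly :: "nat \<Rightarrow> (nat \<Rightarrow> complex) \<Rightarrow> 'd::finite fock \<Rightarrow> 'd fock_op" where
  "weighted_poly N c \<xi> = (\<Sum>w\<in>words N. op_scale (c (length w) * coord \<xi> w) (monomial w))"

lemma weighted_poly_add: "weighted_poly N c (\<xi> + \<eta>) = weighted_poly N c \<xi> + weighted_poly N c \<eta>"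
  by (simp add: weighted_poly_def plus_ell2.rep_eq distrib_left ops.scale_left_distrib sum.distrib)

lemma weighted_poly_diff: "weighted_poly N c (\<xi> - \<eta>) = weighted_poly N c \<xi> - weighted_poly N c \<eta>"
  by (simp add: weighted_poly_def minus_ell2.rep_eq right_diff_distrib ops.scale_left_diff_distrib sum_subtractf)

lemma weighted_poly_cscale: "weighted_poly N c (cscale k \<xi>) = op_scale k (weighted_poly N c \<xi>)"
  by (simp add: weighted_poly_def cscale.rep_eq ops.scale_sum_right mult.left_commute)

lemma weighted_poly_zero: "weighted_poly N c 0 = 0"
  by (simp add: weighted_poly_def zero_ell2.rep_eq)

lemma weighted_poly_ket: "weighted_poly N c (ket w) = (if length w < N then op_scale (c (length w)) (monomial w) else 0)"
proof -
  have "weighted_poly N c (ket w)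
      = (\<Sum>v\<in>words N. if v = w then op_scale (c (length w)) (monomial w) else 0)"
    unfolding weighted_poly_def by (rule sum.cong) (auto simp: ket.rep_eq)
  then show ?thesis by (simp add: finite_words) (simp add: words_def)
qed

lemma weighted_poly_cong_coeff:
  assumes "\<And>w. w \<in> words N \<Longrightarrow> c (length w) * coord \<xi> w = c' (length w) * coord \<xi>' w"
  shows "weighted_poly N c \<xi> = weighted_poly N c' \<xi>'"
  unfolding weighted_poly_def using assms by (intro sum.cong) auto

lemma weighted_poly_shrink:
  assumes "N \<le> L" "\<And>w. N \<le> length w \<Longrightarrow> c (length w) * coord \<xi> w = 0"
  shows "weighted_poly L c \<xi> = weighted_poly N c \<xi>"
  unfolding weighted_poly_def
  by (rule sum.mono_neutral_right)
     (use assms finite_words[of L] in \<open>auto simp: words_def not_less dest: assms(2)\<close>)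

lemma coord_sum: "coord (\<Sum>i\<in>S. g i) w = (\<Sum>i\<in>S. coord (g i) w)"
  by (induction S rule: infinite_finite_induct) (auto simp: zero_ell2.rep_eq plus_ell2.rep_eq)

lemma Ev_weighted_poly: "Ev (weighted_poly N c \<xi>) = (\<Sum>w\<in>words N. cscale (c (length w) * coord \<xi> w) (ket w))"
  by (simp add: weighted_poly_def Ev_sum Ev_linear Ev_monomial)

lemma coord_Ev_weighted_poly:
  "coord (Ev (weighted_poly N c \<xi>)) w = (if length w < N then c (length w) * coord \<xi> w else 0)"
proof -
  have "coord (Ev (weighted_poly N c \<xi>)) w
      = (\<Sum>v\<in>words N. if v = w then c (length w) * coord \<xi> w else 0)"
    unfolding Ev_weighted_poly coord_sum by (rule sum.cong) (auto simp: cscale.rep_eq ket.rep_eq)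
  then show ?thesis by (simp add: finite_words) (simp add: words_def)
qed

lemma weighted_poly_Ev_weighted_poly:
  "weighted_poly N (\<lambda>_. 1) (Ev (weighted_poly N c \<xi>)) = weighted_poly N c \<xi>"
  unfolding weighted_poly_def[of N "\<lambda>_. 1"] unfolding weighted_poly_def[of N c \<xi>, symmetric]
  by (simp add: coord_Ev_weighted_poly) (simp add: weighted_poly_def words_def)

lemma norm_monomial_le: "norm (monomial w) \<le> 1"
proof (rule norm_blinfun_bound)
  show "norm (blinfun_apply (monomial w) x) \<le> 1 * norm x" for x
    by (induction w) (simp_all add: monomial_simps norm_creation_apply)
qed simp

lemma norm_weighted_poly_le: "norm (weighted_poly N (\<lambda>_. 1) (\<xi> :: 'd::finite fock)) \<le> card (words N :: 'd list set) * norm \<xi>"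
proof -
  have "norm (weighted_poly N (\<lambda>_. 1) \<xi>) \<le> (\<Sum>w\<in>(words N :: 'd list set). norm \<xi>)"
    unfolding weighted_poly_def
  proof (rule sum_norm_le)
    fix w :: "'d list"
    have "norm (op_scale (1 * coord \<xi> w) (monomial w)) \<le> norm \<xi> * 1"
      unfolding norm_op_scale by (intro mult_mono norm_monomial_le) (auto simp: norm_coord_le)
    then show "norm (op_scale (1 * coord \<xi> w) (monomial w)) \<le> norm \<xi>" by simp
  qed
  then show ?thesis by simp
qed

text \<open>The expansion holds for all large cut-offs, so that several polynomials can be expanded to a
  common degree.\<close>

lemma nc_poly_expansion:
  assumes "a \<in> nc_polys"
  obtains L where "\<And>N. N \<ge> L \<Longrightarrow> weighted_poly N (\<lambda>_. 1) (Ev a) = a"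
proof -
  have "\<exists>L. \<forall>N\<ge>L. weighted_poly N (\<lambda>_. 1) (Ev a) = a"
    using assms unfolding nc_polys_eq_span
  proof (induction rule: ops.span_induct_alt)
    case base
    then show ?case by (simp add: Ev_zero weighted_poly_zero)
  next
    case (step c x y)
    then obtain w L where "x = monomial w" and "\<forall>N\<ge>L. weighted_poly N (\<lambda>_. 1) (Ev y) = y" by auto
    then show ?case
      by (intro exI[of _ "max L (Suc (length w))"])
         (auto simp: Ev_linear weighted_poly_add weighted_poly_cscale Ev_monomial weighted_poly_ket)
  qed
  then show ?thesis using that by blast
qed

lemma weighted_poly_homogeneous:
  assumes "a \<in> homogeneous k"
  shows "weighted_poly N c (Ev a) = (if k < N then op_scale (c k) a else 0)"
  using assms unfolding homogeneous_def
proof (induction rule: ops.span_induct_alt)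
  case base
  then show ?case by (simp add: Ev_zero weighted_poly_zero)
next
  case (step t x y)
  then obtain w where "x = monomial w" "length w = k" by auto
  then show ?case
    using step by (auto simp: Ev_linear weighted_poly_add weighted_poly_cscale Ev_monomial weighted_poly_ket
        ops.scale_right_distrib mult.commute)
qed

lemma graded_ideal_subspace: "graded_ideal I \<Longrightarrow> ops.subspace I"
  unfolding graded_ideal_def by (metis ops.subspace_span)

lemma graded_ideal_subset: "graded_ideal I \<Longrightarrow> I \<subseteq> nc_polys"
  unfolding graded_ideal_def
  using ideal.Icarr[of I "op_algebra nc_polys"] by (auto simp: op_algebra_def)

text \<open>The map multiplies the component of degree \<open>k\<close> by \<open>c k\<close> or drops it, and a graded ideal
  contains the homogeneous components of its elements.\<close>

lemma graded_ideal_weighted_poly: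
  assumes I: "graded_ideal I" and a: "a \<in> I"
  shows "weighted_poly N c (Ev a) \<in> I"
proof -
  obtain J where J: "\<And>k. k \<ge> 1 \<Longrightarrow> ops.subspace (J k)" "\<And>k. k \<ge> 1 \<Longrightarrow> J k \<subseteq> homogeneous k"
    and IJ: "I = ops.span (\<Union>k\<in>{1..}. J k)"
    using I unfolding graded_ideal_def by blast
  show ?thesis
    using a unfolding IJ
  proof (induction rule: ops.span_induct_alt)
    case base
    then show ?case by (simp add: Ev_zero weighted_poly_zero ops.span_zero)
  next
    case (step t x y)
    then obtain k where k: "k \<ge> 1" "x \<in> J k" by auto
    then have "weighted_poly N c (Ev x) = (if k < N then op_scale (c k) x else 0)"
      using J(2) by (intro weighted_poly_homogeneous) auto
    moreover have "x \<in> ops.span (\<Union>k\<in>{1..}. J k)" using k by (auto intro: ops.span_base)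
    ultimately show ?case
      using step by (auto simp: Ev_linear weighted_poly_add weighted_poly_cscale
          intro!: ops.span_add ops.span_scale)
  qed
qed

section \<open>The gauge action and Fejer means\<close>

text \<open>For \<open>cmod z = 1\<close> this is the unitary that multiplies the component of degree \<open>k\<close> of the Fock
  space by \<open>z ^ k\<close>.\<close>

definition gauge :: "complex \<Rightarrow> 'd fock_op" where
  "gauge z = Blinfun (\<lambda>x. Abs_ell2 (\<lambda>w. z ^ length w * coord x w))"

lemma gauge_unitary:
  assumes z: "cmod z = 1"
  shows coord_gauge: "coord (blinfun_apply (gauge z) x) w = z ^ length w * coord x w"
    and norm_gauge_apply: "norm (blinfun_apply (gauge z) x) = norm x"
proof -
  let ?g = "\<lambda>x. Abs_ell2 (\<lambda>w. z ^ length w * coord x w)"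
  have c: "coord (?g x) = (\<lambda>w. z ^ length w * coord x w)" for x :: "'a fock"
    by (rule Abs_ell2_inverse) (simp add: norm_mult norm_power z coord_sq_summable)
  have n: "norm (?g x) = norm x" for x :: "'a fock"
    by (rule power2_eq_imp_eq) (simp_all add: norm_ell2_sq c norm_mult norm_power z)
  have "bounded_linear (?g :: 'a fock \<Rightarrow> 'a fock)"
  proof (rule bounded_linear_intro[where K = 1])
    fix x y :: "'a fock" and r :: real
    have "coord (?g (x + y)) = coord (?g x + ?g y)"
      unfolding plus_ell2.rep_eq[of "?g x" "?g y"] unfolding c
      by (simp add: fun_eq_iff plus_ell2.rep_eq distrib_left)
    then show "?g (x + y) = ?g x + ?g y" by (simp only: coord_inject)
    have "coord (?g (r *\<^sub>R x)) = coord (r *\<^sub>R ?g x)"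
      unfolding scaleR_ell2.rep_eq[of r "?g x"] unfolding c
      by (simp add: fun_eq_iff scaleR_ell2.rep_eq mult.left_commute)
    then show "?g (r *\<^sub>R x) = r *\<^sub>R ?g x" by (simp only: coord_inject)
    show "norm (?g x) \<le> norm x * 1" by (simp add: n)
  qed
  then have g: "blinfun_apply (gauge z) x = ?g x"
    unfolding gauge_def by (simp add: bounded_linear_Blinfun_apply)
  show "coord (blinfun_apply (gauge z) x) w = z ^ length w * coord x w" by (simp add: g c)
  show "norm (blinfun_apply (gauge z) x) = norm x" by (simp add: g n)
qed

lemma norm_gauge_le: "cmod z = 1 \<Longrightarrow> norm (gauge z) \<le> 1"
  by (rule norm_blinfun_bound) (simp_all add: norm_gauge_apply)

lemma gauge_creation:
  assumes "cmod z = 1"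
  shows "gauge z o\<^sub>L creation j = op_scale z (creation j o\<^sub>L gauge z)"
proof (rule blinfun_eqI)
  fix x
  show "blinfun_apply (gauge z o\<^sub>L creation j) x = blinfun_apply (op_scale z (creation j o\<^sub>L gauge z)) x"
    by (simp add: coord_inject[symmetric] fun_eq_iff coord_gauge[OF assms] op_scale_apply cscale.rep_eq
        creation.rep_eq creation_vec.rep_eq split: list.split)
qed

lemma gauge_cscale:
  "cmod z = 1 \<Longrightarrow> blinfun_apply (gauge z) (cscale c x) = cscale c (blinfun_apply (gauge z) x)"
  by (simp add: coord_inject[symmetric] fun_eq_iff coord_gauge cscale.rep_eq)

definition gauge_action :: "complex \<Rightarrow> 'd fock_op \<Rightarrow> 'd fock_op" where
  "gauge_action z a = gauge z o\<^sub>L a o\<^sub>L gauge (cnj z)"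

lemma norm_gauge_action_le:
  assumes "cmod z = 1"
  shows "norm (gauge_action z a) \<le> norm a"
proof -
  have "norm (gauge_action z a) \<le> norm (gauge z o\<^sub>L a) * norm (gauge (cnj z) :: 'a fock_op)"
    unfolding gauge_action_def by (rule norm_blinfun_compose)
  also have "\<dots> \<le> norm (gauge z :: 'a fock_op) * norm a * norm (gauge (cnj z) :: 'a fock_op)"
    by (intro mult_right_mono norm_blinfun_compose) simp
  also have "\<dots> \<le> 1 * norm a * 1"
    using assms by (intro mult_mono norm_gauge_le) auto
  finally show ?thesis by simp
qed

text \<open>Moving the unitary past each creation operator produces one factor \<open>z\<close>; at the end \<open>gauge z\<close>
  meets its inverse \<open>gauge (cnj z)\<close>.\<close>

lemma gauge_action_monomial:
  assumes "cmod z = 1"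
  shows "gauge_action z (monomial w) = op_scale (z ^ length w) (monomial w)"
proof (induction w)
  case Nil
  have "z * cnj z = 1" using assms by (simp add: complex_norm_square[symmetric])
  then have "z ^ n * cnj z ^ n = 1" for n by (metis power_mult_distrib power_one)
  then show ?case
    using assms by (auto intro!: blinfun_eqI simp: gauge_action_def monomial_simps
        coord_inject[symmetric] fun_eq_iff coord_gauge op_scale_apply mult.assoc[symmetric] cscale_simps)
next
  case (Cons j w)
  have "gauge_action z (monomial (j # w)) = (gauge z o\<^sub>L creation j) o\<^sub>L (monomial w o\<^sub>L gauge (cnj z))"
    by (auto intro!: blinfun_eqI simp: gauge_action_def monomial_simps)
  also have "\<dots> = op_scale z (creation j o\<^sub>L gauge_action z (monomial w))"
    by (auto intro!: blinfun_eqI simp: gauge_action_def gauge_creation[OF assms] op_scale_apply)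
  finally show ?case by (simp add: Cons.IH creation_comp_linear monomial_simps)
qed

lemma gauge_action_sum_scale:
  assumes "cmod z = 1"
  shows "gauge_action z (\<Sum>i\<in>S. op_scale (f i) (g i)) = (\<Sum>i\<in>S. op_scale (f i) (gauge_action z (g i)))"
  by (rule blinfun_eqI)
     (simp add: gauge_action_def blinfun.sum_left blinfun.sum_right op_scale_apply gauge_cscale assms)

lemma gauge_action_weighted_poly:
  assumes "cmod z = 1"
  shows "gauge_action z (weighted_poly N c \<xi>) = weighted_poly N (\<lambda>k. z ^ k * c k) \<xi>"
  unfolding weighted_poly_def gauge_action_sum_scale[OF assms] gauge_action_monomial[OF assms]
  by (simp add: mult.commute mult.left_commute)

lemma sum_powers_roots_of_unity:
  fixes M :: nat
  defines "\<omega> \<equiv> cis (2 * pi / real M)"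
  assumes "M > 0"
  shows "(\<Sum>j<M. (\<omega> ^ j) ^ e) = (if M dvd e then of_nat M else 0)"
proof -
  have \<omega>: "\<omega> = exp (2 * of_real pi * \<i> * of_nat 1 / of_nat M)"
    by (simp add: \<omega>_def cis_conv_exp mult_ac)
  have \<omega>e: "\<omega> ^ e = 1 \<longleftrightarrow> M dvd e"
  proof -
    have "\<omega> ^ e = exp (2 * of_real pi * \<i> * of_nat e / of_nat M)"
      unfolding \<omega> exp_of_nat_mult[symmetric] by (simp add: mult_ac)
    then show ?thesis
      using complex_root_unity_eq[of M e 0] \<open>M > 0\<close> by (simp add: mod_eq_0_iff_dvd)
  qed
  have swap: "(\<omega> ^ j) ^ e = (\<omega> ^ e) ^ j" for j by (simp add: power_mult[symmetric] mult.commute)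
  show ?thesis
  proof (cases "M dvd e")
    case True
    then have "\<omega> ^ e = 1" by (simp add: \<omega>e)
    then show ?thesis using True by (simp add: swap)
  next
    case False
    have "(\<omega> ^ e) ^ M = (\<omega> ^ M) ^ e" by (simp add: power_mult[symmetric] mult.commute)
    also have "\<omega> ^ M = 1" using \<open>M > 0\<close> by (simp add: \<omega>_def Complex.DeMoivre)
    finally show ?thesis using False \<omega>e by (simp add: swap geometric_sum)
  qed
qed

text \<open>For \<open>N > 0\<close> this is \<open>max 0 (1 - k / N)\<close>, because subtraction of natural numbers truncates.\<close>

definition fejer :: "nat \<Rightarrow> nat \<Rightarrow> complex" where
  "fejer N k = of_nat (N - k) / of_nat N"

text \<open>The Fejer kernel \<open>\<bar>\<Sum>\<^bsub>p<N\<^esub> z\<^sup>p\<bar>\<^sup>2 / N\<close> at the \<open>j\<close>-th \<open>M\<close>-th root of unity, divided by the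
  number of roots. Only polynomials are averaged, so finitely many points of the circle replace
  the integral over it.\<close>

definition fejer_weight :: "nat \<Rightarrow> nat \<Rightarrow> nat \<Rightarrow> real" where
  "fejer_weight N M j = (cmod (\<Sum>p<N. (cis (2 * pi / real M) ^ j) ^ p))\<^sup>2 / (real N * real M)"

text \<open>Expanding the square, the sum over \<open>j\<close> counts the pairs \<open>p, q < N\<close> with \<open>p + k \<equiv> q\<close> modulo
  \<open>M\<close>. With \<open>M = N + L\<close> roots there is no aliasing for \<open>k < L\<close>: the congruence is an equality, and
  \<open>N - k\<close> pairs satisfy it.\<close>

lemma sum_fejer_weight:
  assumes N: "N > 0" and kL: "k < L" and M: "M = N + L"
  shows "(\<Sum>j<M. of_real (fejer_weight N M j) * (cis (2 * pi / real M) ^ j) ^ k) = fejer N k"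
proof -
  define z where "z = (\<lambda>j. cis (2 * pi / real M) ^ j)"
  have M0: "M > 0" using N M by simp
  have norm_z: "cmod (z j) = 1" for j by (simp add: z_def norm_power)
  have zM: "z j ^ M = 1" for j
  proof -
    have "z j ^ M = (cis (2 * pi / real M) ^ M) ^ j"
      by (simp add: z_def power_mult[symmetric] mult.commute)
    also have "cis (2 * pi / real M) ^ M = 1"
      using M0 unfolding Complex.DeMoivre by simp
    finally show ?thesis by simp
  qed
  \<comment> \<open>Writing conjugates as positive powers keeps all exponents natural numbers.\<close>
  have cnj_z: "cnj (z j ^ q) = z j ^ (M - q)" if "q < N" for j q
  proof -
    have "z j ^ q * z j ^ (M - q) = 1" using that M zM by (simp add: power_add[symmetric])
    moreover have "z j ^ q * cnj (z j ^ q) = 1"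
      by (simp add: complex_norm_square[symmetric] norm_power norm_z del: complex_cnj_power)
    ultimately show ?thesis by (metis mult_cancel_left mult_zero_left zero_neq_one)
  qed
  have summand: "of_real (fejer_weight N M j) * z j ^ k
      = (\<Sum>p<N. \<Sum>q<N. z j ^ (p + (M - q) + k)) / (of_nat N * of_nat M)" for j
  proof -
    have "complex_of_real ((cmod (\<Sum>p<N. z j ^ p))\<^sup>2) = (\<Sum>p<N. z j ^ p) * (\<Sum>q<N. cnj (z j ^ q))"
      by (simp only: complex_norm_square cnj_sum)
    also have "(\<Sum>q<N. cnj (z j ^ q)) = (\<Sum>q<N. z j ^ (M - q))"
      by (rule sum.cong) (simp_all only: cnj_z lessThan_iff)
    also have "(\<Sum>p<N. z j ^ p) * \<dots> = (\<Sum>p<N. \<Sum>q<N. z j ^ p * z j ^ (M - q))"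
      by (rule sum_product)
    finally show ?thesis
      by (simp add: fejer_weight_def z_def[symmetric] sum_distrib_right power_add)
  qed
  have dvd: "M dvd (p + (M - q) + k) \<longleftrightarrow> q = p + k" if "p < N" "q < N" for p q
  proof
    assume "M dvd (p + (M - q) + k)"
    then obtain t where t: "p + (M - q) + k = M * t" by blast
    have "M * t < M * 2" "M * t > 0" using that M kL N t by linarith+
    then have "t = 1" by auto
    then show "q = p + k" using t that M by simp
  next
    assume "q = p + k"
    then have "p + (M - q) + k = M" using that M by simp
    then show "M dvd (p + (M - q) + k)" by simp
  qed
  have "(\<Sum>j<M. of_real (fejer_weight N M j) * z j ^ k)
      = (\<Sum>j<M. \<Sum>p<N. \<Sum>q<N. z j ^ (p + (M - q) + k)) / (of_nat N * of_nat M)"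
    by (simp only: summand sum_divide_distrib)
  also have "(\<Sum>j<M. \<Sum>p<N. \<Sum>q<N. z j ^ (p + (M - q) + k))
      = (\<Sum>p<N. \<Sum>q<N. \<Sum>j<M. z j ^ (p + (M - q) + k))"
    by (subst sum.swap) (intro sum.cong refl sum.swap)
  also have "\<dots> = (\<Sum>p<N. \<Sum>q<N. if q = p + k then of_nat M else 0)"
    using sum_powers_roots_of_unity[OF M0] by (intro sum.cong refl) (simp add: z_def dvd)
  also have "\<dots> = (\<Sum>p<N. if p + k < N then of_nat M else 0)"
    by (intro sum.cong refl) simp
  also have "\<dots> = of_nat (N - k) * of_nat M"
  proof -
    have "{p. p < N \<and> p + k < N} = {..<N - k}" by auto
    then show ?thesis
      by (simp add: sum.If_cases Int_def lessThan_def[symmetric]) 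
  qed
  finally show ?thesis using M0 by (simp add: z_def fejer_def)
qed

text \<open>The Fejer mean is a convex combination of the operators \<open>gauge_action z b\<close> with \<open>z\<close> a root
  of unity: the weights are nonnegative, and \<open>sum_fejer_weight\<close> for \<open>k = 0\<close> says that they add up
  to 1.\<close>

lemma norm_fejer_mean_le:
  assumes b: "b \<in> nc_polys" and N: "N > 0"
  shows "norm (weighted_poly N (fejer N) (Ev b)) \<le> norm b"
proof -
  obtain L0 where L0: "\<And>L. L \<ge> L0 \<Longrightarrow> weighted_poly L (\<lambda>_. 1) (Ev b) = b"
    using nc_poly_expansion[OF b] by blast
  define L where "L = max L0 N"
  define M where "M = N + L"
  define z where "z = (\<lambda>j. cis (2 * pi / real M) ^ j)"
  define l where "l = fejer_weight N M"
  have L: "weighted_poly L (\<lambda>_. 1) (Ev b) = b" "L > 0" "N \<le> L" using L0 N by (simp_all add: L_def)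
  have z: "cmod (z j) = 1" for j by (simp add: z_def norm_power)
  have l: "(\<Sum>j<M. of_real (l j) * z j ^ k) = fejer N k" if "k < L" for k
    unfolding l_def z_def by (rule sum_fejer_weight[OF N that M_def])
  have l_nonneg: "l j \<ge> 0" for j by (simp add: l_def fejer_weight_def)
  have "(\<Sum>j<M. complex_of_real (l j)) = fejer N 0" using l[of 0] \<open>L > 0\<close> by simp
  then have sum_l: "(\<Sum>j<M. l j) = 1"
    using N by (simp add: fejer_def of_real_sum[symmetric] del: of_real_sum)
  have "(\<Sum>j<M. op_scale (of_real (l j)) (gauge_action (z j) b))
      = (\<Sum>j<M. op_scale (of_real (l j)) (weighted_poly L (\<lambda>k. z j ^ k) (Ev b)))"
    using gauge_action_weighted_poly[OF z, of _ L "\<lambda>_. 1" "Ev b"] L(1) by simp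
  also have "\<dots> = weighted_poly L (\<lambda>k. \<Sum>j<M. of_real (l j) * z j ^ k) (Ev b)"
    unfolding weighted_poly_def ops.scale_sum_right sum_distrib_right ops.scale_sum_left
    by (subst sum.swap) (simp add: mult.assoc)
  also have "\<dots> = weighted_poly L (fejer N) (Ev b)"
    by (rule weighted_poly_cong_coeff) (simp add: words_def l)
  also have "\<dots> = weighted_poly N (fejer N) (Ev b)"
    by (rule weighted_poly_shrink) (auto simp: L fejer_def)
  finally have "norm (weighted_poly N (fejer N) (Ev b))
      = norm (\<Sum>j<M. op_scale (of_real (l j)) (gauge_action (z j) b))" by simp
  also have "\<dots> \<le> (\<Sum>j<M. l j * norm b)"
    by (rule sum_norm_le) (auto simp: norm_op_scale l_nonneg intro!: mult_left_mono norm_gauge_action_le z)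
  also have "\<dots> = norm b" by (simp add: sum_distrib_right[symmetric] sum_l)
  finally show ?thesis .
qed

text \<open>For large \<open>N\<close> the coefficient of the monomial of \<open>w\<close> loses the fraction \<open>length w / N\<close> of
  itself, which tends to 0, and only finitely many monomials occur.\<close>

lemma fejer_mean_approximates:
  assumes b: "b \<in> nc_polys" and e: "e > 0"
  obtains N where "N > 0" "norm (b - weighted_poly N (fejer N) (Ev b)) < e"
proof -
  obtain L where L: "\<And>N. N \<ge> L \<Longrightarrow> weighted_poly N (\<lambda>_. 1) (Ev b) = b"
    using nc_poly_expansion[OF b] by blast
  have zero: "coord (Ev b) w = 0" if "L \<le> length w" for w
    using coord_Ev_weighted_poly[of L "\<lambda>_. 1" "Ev b" w] L[of L] that by simp
  define C where "C = (\<Sum>w\<in>words L. real (length w) * cmod (coord (Ev b) w))"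
  obtain N where N: "real N > max (real (Suc L)) (C / e)" using reals_Archimedean2 by blast
  then have NL: "N > 0" "N \<ge> L" "C / e < real N" by auto
  have "weighted_poly N (fejer N) (Ev b) = weighted_poly L (fejer N) (Ev b)"
    by (rule weighted_poly_shrink) (auto simp: zero NL)
  then have "b - weighted_poly N (fejer N) (Ev b) = weighted_poly L (\<lambda>k. 1 - fejer N k) (Ev b)"
    using L[of L]
    by (simp add: weighted_poly_def sum_subtractf ops.scale_left_diff_distrib left_diff_distrib)
  also have "norm \<dots> \<le> (\<Sum>w\<in>words L. real (length w) * cmod (coord (Ev b) w) / real N)"
    unfolding weighted_poly_def
  proof (rule sum_norm_le)
    fix w :: "'a list" assume "w \<in> words L"
    then have "length w \<le> N" using NL by (simp add: words_def)
    then have "1 - fejer N (length w) = of_real (real (length w) / real N)"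
      using NL by (simp add: fejer_def of_nat_diff field_simps)
    then have "norm (op_scale ((1 - fejer N (length w)) * coord (Ev b) w) (monomial w))
        = real (length w) * cmod (coord (Ev b) w) / real N * norm (monomial w)"
      by (simp add: norm_op_scale norm_mult norm_divide)
    also have "\<dots> \<le> real (length w) * cmod (coord (Ev b) w) / real N * 1"
      by (intro mult_left_mono norm_monomial_le) simp
    finally show "norm (op_scale ((1 - fejer N (length w)) * coord (Ev b) w) (monomial w))
        \<le> real (length w) * cmod (coord (Ev b) w) / real N" by simp
  qed
  also have "\<dots> = C / real N" by (simp add: C_def sum_divide_distrib)
  also have "\<dots> < e" using NL e by (simp add: field_simps)
  finally show ?thesis using that NL by blast
qed

section \<open>Distances to a subspace\<close>

lemma infdist_closure: "infdist x (closure A) = infdist x A"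
proof (cases "A = {}")
  case False
  show ?thesis
  proof (rule antisym)
    show "infdist x (closure A) \<le> infdist x A"
      by (rule infdist_mono) (auto simp: closure_subset False)
    have "infdist x A \<le> dist x y" if "y \<in> closure A" for y
      using that infdist_triangle[of x A y] in_closure_iff_infdist_zero[OF False] by simp
    then show "infdist x A \<le> infdist x (closure A)"
      using False by (subst infdist_notempty[of "closure A"]) (auto intro!: cINF_greatest)
  qed
qed simp

lemma infdist_approx:
  assumes "A \<noteq> {}" "e > 0"
  obtains y where "y \<in> A" "dist x y < infdist x A + e"
proof -
  have "(INF a\<in>A. dist x a) < infdist x A + e" using assms by (simp add: infdist_notempty)
  then show ?thesis using assms that by (subst (asm) cINF_less_iff) auto
qed

lemma infdist_add_le:
  fixes a b :: "'a::real_normed_vector"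
  assumes J: "subspace J"
  shows "infdist (a + b) J \<le> infdist a J + infdist b J"
proof (rule field_le_epsilon)
  fix e :: real assume e: "e > 0"
  have ne: "J \<noteq> {}" using subspace_0[OF J] by auto
  obtain i where i: "i \<in> J" "dist a i < infdist a J + e / 2"
    by (rule infdist_approx[OF ne, of "e / 2" a]) (use e in auto)
  obtain j where j: "j \<in> J" "dist b j < infdist b J + e / 2"
    by (rule infdist_approx[OF ne, of "e / 2" b]) (use e in auto)
  have "infdist (a + b) J \<le> dist (a + b) (i + j)"
    by (rule infdist_le[OF subspace_add[OF J i(1) j(1)]])
  also have "\<dots> \<le> dist a i + dist b j" unfolding dist_norm by (rule norm_diff_triangle_ineq)
  finally show "infdist (a + b) J \<le> infdist a J + infdist b J + e" using i j by simp
qed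

section \<open>Graded ideals and their projections\<close>

text \<open>\<open>P (Ev a)\<close> is orthogonal to \<open>Ev a\<close> and to \<open>Ev a - P (Ev a)\<close>, hence to itself.\<close>

lemma ideal_projection_vanishes:
  assumes P: "ideal_projection I P" and a: "a \<in> I"
  shows "blinfun_apply P (Ev a) = 0"
proof -
  let ?y = "blinfun_apply P (Ev a)"
  have y: "?y \<in> orth_compl (Ev ` I)" and r: "Ev a - ?y \<in> orth_compl (orth_compl (Ev ` I))"
    using P by (auto simp: ideal_projection_def orth_projection_onto_def)
  have "cinner ?y (Ev a) = 0"
    using y a cinner_commute[of "Ev a" ?y] by (auto simp: orth_compl_def)
  moreover have "cinner ?y (Ev a - ?y) = 0" using r y by (auto simp: orth_compl_def)
  ultimately show ?thesis by (intro cinner_eq_zero) (simp add: cinner_diff_right)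
qed

lemma cinner_weighted_poly_truncate:
  assumes "\<And>w. N \<le> length w \<Longrightarrow> coord u w = 0"
  shows "cinner u (Ev (weighted_poly N (\<lambda>_. 1) \<xi>)) = cinner u \<xi>"
  unfolding cinner.rep_eq by (rule infsum_cong) (simp add: coord_Ev_weighted_poly assms)

text \<open>The vector \<open>\<xi> - P \<xi>\<close> lies in the double orthogonal complement of \<open>Ev ` I\<close>, so in general
  only in the closure of \<open>Ev ` I\<close>. Its part of degree less than \<open>N\<close> is in \<open>Ev ` I\<close> itself, since
  the part \<open>V\<close> of degree less than \<open>N\<close> of \<open>I\<close> is finite-dimensional: the component \<open>u\<close> of the
  truncated vector orthogonal to \<open>Ev ` V\<close> is orthogonal to all of \<open>Ev ` I\<close>, because \<open>I\<close> is graded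
  and \<open>u\<close> has low degree. Hence \<open>u\<close> is orthogonal to \<open>\<xi> - P \<xi>\<close>, and so to itself.\<close>

lemma weighted_poly_residual_in_ideal:
  fixes I :: "'d::finite fock_op set"
  assumes I: "graded_ideal I" and P: "ideal_projection I P"
  shows "weighted_poly N (\<lambda>_. 1) (\<xi> - blinfun_apply P \<xi>) \<in> I"
proof -
  let ?T = "\<lambda>\<eta>. weighted_poly N (\<lambda>_. 1) \<eta>"
  define V where "V = {b \<in> I. ?T (Ev b) = b}"
  define \<eta> where "\<eta> = \<xi> - blinfun_apply P \<xi>"
  have subI: "ops.subspace I" by (rule graded_ideal_subspace[OF I])
  have subV: "ops.subspace V"
    using subI unfolding V_def ops.subspace_def
    by (auto simp: Ev_zero weighted_poly_zero Ev_linear weighted_poly_add weighted_poly_cscale)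
  obtain B where B: "B \<subseteq> V" "ops.independent B" "V \<subseteq> ops.span B"
    by (meson ops.basis_exists)
  have "V \<subseteq> ops.span (monomial ` (words N :: 'd list set))"
  proof
    fix b assume "b \<in> V"
    then have "b = ?T (Ev b)" by (simp add: V_def)
    also have "\<dots> \<in> ops.span (monomial ` words N)"
      unfolding weighted_poly_def by (intro ops.span_sum ops.span_scale ops.span_base) auto
    finally show "b \<in> ops.span (monomial ` words N)" .
  qed
  then have "finite B"
    using ops.independent_span_bound[OF finite_imageI[OF finite_words] B(2)] B(1) by blast
  then obtain v where v: "v \<in> ops.span B"
    and orth: "\<And>b. b \<in> ops.span B \<Longrightarrow> cinner (Ev b) (Ev (?T \<eta>) - Ev v) = 0"
    using finite_span_best_approximation by metis
  have spanB: "ops.span B = V"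
    using B(1,3) ops.span_minimal[OF B(1) subV] by blast
  then have vV: "v \<in> V" "?T (Ev v) = v" "v \<in> I" using v by (auto simp: V_def)
  define u where "u = Ev (?T \<eta>) - Ev v"
  have u0: "coord u w = 0" if "N \<le> length w" for w
    using that vV(2) coord_Ev_weighted_poly[of N "\<lambda>_. 1" "Ev v" w]
    by (simp add: u_def minus_ell2.rep_eq coord_Ev_weighted_poly)
  have "cinner (Ev b) u = 0" if "b \<in> I" for b
  proof -
    have "?T (Ev b) \<in> V"
      using graded_ideal_weighted_poly[OF I that] by (simp add: V_def weighted_poly_Ev_weighted_poly)
    then have "cinner (Ev (?T (Ev b))) u = 0" using orth spanB by (simp add: u_def)
    then have "cinner u (Ev b) = 0"
      using cinner_weighted_poly_truncate[OF u0, where \<xi> = "Ev b"] cinner_commute[of _ u] by simp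
    then show ?thesis using cinner_commute[of "Ev b" u] by simp
  qed
  then have "u \<in> orth_compl (Ev ` I)" by (auto simp: orth_compl_def)
  then have "cinner u \<eta> = 0"
    using P by (auto simp: ideal_projection_def orth_projection_onto_def orth_compl_def \<eta>_def)
  then have "cinner u (Ev (?T \<eta>)) = 0" using cinner_weighted_poly_truncate[OF u0, where \<xi> = \<eta>] by simp
  moreover have "cinner u (Ev v) = 0"
    using orth[of v] v cinner_commute[of u "Ev v"] by (simp add: u_def)
  ultimately have "u = 0" by (intro cinner_eq_zero) (simp add: u_def cinner_diff_right)
  then have "?T \<eta> = v" using vV(2) weighted_poly_Ev_weighted_poly[of N "\<lambda>_. 1" \<eta>] by (simp add: u_def)
  then show ?thesis using vV by (simp add: \<eta>_def)
qed

section \<open>Comparing the distances to two ideals\<close>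

text \<open>A real-linear operator is controlled on the complex line through \<open>x\<close> by its values at \<open>x\<close>
  and \<open>\<i> x\<close>; this is applied to a difference of projections at the basis vectors.\<close>

lemma blinfun_apply_cscale_le:
  assumes "norm (blinfun_apply D x) \<le> d" "norm (blinfun_apply D (cscale \<i> x)) \<le> d"
  shows "norm (blinfun_apply D (cscale c x)) \<le> 2 * cmod c * d"
proof -
  have "cscale c x = Re c *\<^sub>R x + Im c *\<^sub>R cscale \<i> x"
    by (simp add: cscale_of_real[symmetric] cscale_simps complex_eq[symmetric]
        cscale_simps(2)[symmetric] mult.commute)
  then have "norm (blinfun_apply D (cscale c x))
      \<le> \<bar>Re c\<bar> * norm (blinfun_apply D x) + \<bar>Im c\<bar> * norm (blinfun_apply D (cscale \<i> x))"
    by (simp add: blinfun.add_right blinfun.scaleR_right) (metis norm_scaleR norm_triangle_ineq)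
  also have "\<dots> \<le> cmod c * d + cmod c * d"
    using assms by (intro add_mono mult_mono abs_Re_le_cmod abs_Im_le_cmod) auto
  finally show ?thesis by (simp add: mult.commute)
qed

text \<open>The finite set \<open>F\<close> and the tolerance \<open>d\<close> depend on \<open>a\<close> and \<open>e\<close> only, not on the ideals.
  Given an almost best approximant \<open>b\<close> of \<open>a\<close> in \<open>J\<close>, its Fejer mean is still in \<open>J\<close>, still
  approximates \<open>a\<close>, and has degree less than \<open>N\<close>; moving it into \<open>I\<close> by
  \<open>weighted_poly_residual_in_ideal\<close> changes it little, because \<open>Q\<close> vanishes on its vector and \<open>P\<close>
  is close to \<open>Q\<close> there.\<close>

lemma infdist_ideal_compare:
  fixes a :: "'d::finite fock_op"
  assumes a: "a \<in> nc_polys" and e: "e > 0"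
  obtains F :: "'d fock set" and d where "finite F" "d > 0"
    "\<And>I J P Q. \<lbrakk>graded_ideal I; ideal_projection I P; graded_ideal J; ideal_projection J Q;
        \<And>\<xi>. \<xi> \<in> F \<Longrightarrow> norm (blinfun_apply P \<xi> - blinfun_apply Q \<xi>) \<le> d\<rbrakk>
      \<Longrightarrow> infdist a I \<le> infdist a J + e"
proof -
  obtain N where N: "N > 0" and Na: "norm (a - weighted_poly N (fejer N) (Ev a)) < e / 4"
    using fejer_mean_approximates[OF a, of "e / 4"] e by auto
  let ?T = "\<lambda>b. weighted_poly N (fejer N) (Ev b)"
  define W :: "'d list set" where "W = words N"
  have finW: "finite W" by (simp add: W_def finite_words)
  define K where "K = real (card W) + 1"
  \<comment> \<open>\<open>K * (K * (2 * (2 * norm a + 1) * d)) = e / 4\<close>: one factor \<open>K\<close> from the norm of a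
      polynomial of degree less than \<open>N\<close>, one from summing over the basis vectors, and
      \<open>2 * norm a + 1\<close> bounds the norm of \<open>b\<close>.\<close>
  define d where "d = e / (8 * K * K * (2 * norm a + 1))"
  define F where "F = ket ` W \<union> cscale \<i> ` ket ` W"
  have K: "K > 0" by (simp add: K_def)
  have d: "d > 0" using e K by (simp add: d_def add_nonneg_pos)
  show ?thesis
  proof (rule that)
    show "finite F" by (simp add: F_def finW)
    show "d > 0" by (rule d)
    fix I J :: "'d fock_op set" and P Q :: "'d fock_op"
    assume I: "graded_ideal I" "ideal_projection I P" and J: "graded_ideal J" "ideal_projection J Q"
      and close: "\<And>\<xi>. \<xi> \<in> F \<Longrightarrow> norm (blinfun_apply P \<xi> - blinfun_apply Q \<xi>) \<le> d"
    have "0 \<in> J" by (rule ops.subspace_0[OF graded_ideal_subspace[OF J(1)]])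
    then have "J \<noteq> {}" "min (e / 4) 1 > 0" using e by auto
    then obtain b where b: "b \<in> J" and b_dist: "dist a b < infdist a J + min (e / 4) 1"
      by (rule infdist_approx)
    have "infdist a J \<le> norm a" using infdist_le[OF \<open>0 \<in> J\<close>, of a] by simp
    then have ab: "norm (a - b) \<le> infdist a J + e / 4" "norm (a - b) \<le> norm a + 1"
      using b_dist by (auto simp: dist_norm)
    then have norm_b: "norm b \<le> 2 * norm a + 1"
      using norm_triangle_ineq2[of b a] by (simp add: norm_minus_commute)
    have bp: "b \<in> nc_polys" and TbJ: "?T b \<in> J"
      using graded_ideal_subset[OF J(1)] b graded_ideal_weighted_poly[OF J(1) b] by auto
    define \<eta> where "\<eta> = Ev (?T b)"
    define D where "D = P - Q"
    have normTb: "norm (?T b) \<le> 2 * norm a + 1"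
      using norm_fejer_mean_le[OF bp N] norm_b by simp
    have Q\<eta>: "blinfun_apply Q \<eta> = 0"
      unfolding \<eta>_def by (rule ideal_projection_vanishes[OF J(2) TbJ])
    define r where "r = weighted_poly N (\<lambda>_. 1) (\<eta> - blinfun_apply P \<eta>)"
    have rI: "r \<in> I" unfolding r_def by (rule weighted_poly_residual_in_ideal[OF I])
    have "blinfun_apply D \<eta> = blinfun_apply P \<eta>" by (simp add: D_def minus_blinfun.rep_eq Q\<eta>)
    then have "?T b - r = weighted_poly N (\<lambda>_. 1) (blinfun_apply D \<eta>)"
      unfolding r_def weighted_poly_diff by (simp add: \<eta>_def weighted_poly_Ev_weighted_poly)
    then have Tr: "norm (?T b - r) \<le> K * norm (blinfun_apply D \<eta>)"
      using norm_weighted_poly_le[of N "blinfun_apply D \<eta>"]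
      by (simp add: K_def W_def distrib_right add_increasing2)
    have coord_le: "cmod (fejer N (length w) * coord (Ev b) w) \<le> 2 * norm a + 1" if "w \<in> W" for w
    proof -
      have "fejer N (length w) * coord (Ev b) w = coord \<eta> w"
        using that by (simp add: \<eta>_def coord_Ev_weighted_poly W_def words_def)
      also have "cmod \<dots> \<le> norm \<eta>" by (rule norm_coord_le)
      also have "norm \<eta> \<le> norm (?T b) * norm (ket [] :: 'd fock)"
        unfolding \<eta>_def Ev_def[of "?T b"] by (rule norm_blinfun)
      also have "norm (ket [] :: 'd fock) = 1"
        by (simp add: norm_eq_sqrt_inner inner_ell2_def cinner_ket ket.rep_eq)
      finally show ?thesis using normTb by simp
    qed
    have "norm (blinfun_apply D \<eta>) \<le> (\<Sum>w\<in>W. 2 * (2 * norm a + 1) * d)"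
      unfolding \<eta>_def Ev_weighted_poly blinfun.sum_right W_def[symmetric]
    proof (rule sum_norm_le)
      fix w assume w: "w \<in> W"
      have "norm (blinfun_apply D (cscale (fejer N (length w) * coord (Ev b) w) (ket w)))
          \<le> 2 * cmod (fejer N (length w) * coord (Ev b) w) * d"
        using w by (intro blinfun_apply_cscale_le) (auto simp: D_def minus_blinfun.rep_eq F_def intro!: close)
      also have "\<dots> \<le> 2 * (2 * norm a + 1) * d"
        using coord_le[OF w] d by (intro mult_right_mono) auto
      finally show "norm (blinfun_apply D (cscale (fejer N (length w) * coord (Ev b) w) (ket w)))
          \<le> 2 * (2 * norm a + 1) * d" .
    qed
    also have "\<dots> = real (card W) * (2 * (2 * norm a + 1) * d)" by simp
    also have "\<dots> \<le> K * (2 * (2 * norm a + 1) * d)"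
      using d by (intro mult_right_mono) (auto simp: K_def)
    finally have "K * norm (blinfun_apply D \<eta>) \<le> K * (K * (2 * (2 * norm a + 1) * d))"
      using K by (intro mult_left_mono) auto
    also have "\<dots> = e / 4"
    proof -
      have "2 * norm a + 1 \<noteq> 0" using norm_ge_zero[of a] by linarith
      moreover have "K * (K * (2 * B * (e / (8 * K * K * B)))) = e / 4" if "B \<noteq> 0" for B
        using K that by (simp add: field_simps)
      ultimately show ?thesis unfolding d_def by blast
    qed
    finally have Tr': "norm (?T b - r) \<le> e / 4" using Tr by simp
    have "?T a - ?T b = ?T (a - b)" by (simp add: Ev_diff weighted_poly_diff)
    moreover have "a - b \<in> nc_polys" using a bp subspace_nc_polys by (rule ops.subspace_diff[rotated])
    ultimately have "norm (?T a - ?T b) \<le> norm (a - b)" using norm_fejer_mean_le[OF _ N] by metis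
    then have "norm (a - r) \<le> e / 4 + (infdist a J + e / 4) + e / 4"
      using norm_triangle_ineq[of "a - ?T a" "?T a - r"] norm_triangle_ineq[of "?T a - ?T b" "?T b - r"]
        Na Tr' ab by simp
    then show "infdist a I \<le> infdist a J + e"
      using infdist_le[OF rI, of a] e by (simp add: dist_norm)
  qed
qed

section \<open>Complex algebras and their homomorphic images\<close>

lemma cring_complex_ring: "cring complex_ring"
proof (rule cringI)
  show "abelian_group complex_ring"
  proof (rule abelian_groupI)
    show "\<exists>y\<in>carrier complex_ring. y \<oplus>\<^bsub>complex_ring\<^esub> x = \<zero>\<^bsub>complex_ring\<^esub>" for x
      by (rule bexI[of _ "- x"]) (simp_all add: complex_ring_def)
  qed (simp_all add: complex_ring_def)
  show "comm_monoid complex_ring"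
    by (rule comm_monoidI) (simp_all add: complex_ring_def)
qed (simp add: complex_ring_def distrib_right)

lemma complex_algebraI:
  assumes "abelian_group A" "ring A"
    and "\<And>c x. x \<in> carrier A \<Longrightarrow> c \<odot>\<^bsub>A\<^esub> x \<in> carrier A"
    and "\<And>c d x. x \<in> carrier A \<Longrightarrow> (c + d) \<odot>\<^bsub>A\<^esub> x = c \<odot>\<^bsub>A\<^esub> x \<oplus>\<^bsub>A\<^esub> d \<odot>\<^bsub>A\<^esub> x"
    and "\<And>c x y. x \<in> carrier A \<Longrightarrow> y \<in> carrier A \<Longrightarrow>
           c \<odot>\<^bsub>A\<^esub> (x \<oplus>\<^bsub>A\<^esub> y) = c \<odot>\<^bsub>A\<^esub> x \<oplus>\<^bsub>A\<^esub> c \<odot>\<^bsub>A\<^esub> y"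
    and "\<And>c d x. x \<in> carrier A \<Longrightarrow> (c * d) \<odot>\<^bsub>A\<^esub> x = c \<odot>\<^bsub>A\<^esub> (d \<odot>\<^bsub>A\<^esub> x)"
    and "\<And>x. x \<in> carrier A \<Longrightarrow> 1 \<odot>\<^bsub>A\<^esub> x = x"
    and "\<And>c x y. x \<in> carrier A \<Longrightarrow> y \<in> carrier A \<Longrightarrow>
           (c \<odot>\<^bsub>A\<^esub> x) \<otimes>\<^bsub>A\<^esub> y = c \<odot>\<^bsub>A\<^esub> (x \<otimes>\<^bsub>A\<^esub> y)"
    and "\<And>c x y. x \<in> carrier A \<Longrightarrow> y \<in> carrier A \<Longrightarrow>
           x \<otimes>\<^bsub>A\<^esub> (c \<odot>\<^bsub>A\<^esub> y) = c \<odot>\<^bsub>A\<^esub> (x \<otimes>\<^bsub>A\<^esub> y)"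
  shows "complex_algebra A"
proof (intro complex_algebra.intro complex_algebra_axioms.intro)
  show "module complex_ring A"
    by (rule moduleI[OF cring_complex_ring])
       (use assms in \<open>simp_all add: complex_ring_def\<close>)
qed (use assms in auto)

lemma complex_algebra_nc_disk: "complex_algebra (op_algebra (nc_disk :: 'd::finite fock_op set))"
proof -
  let ?A = "op_algebra (nc_disk :: 'd fock_op set)"
  have ag: "abelian_group ?A"
  proof (rule abelian_groupI)
    show "\<exists>b\<in>carrier ?A. b \<oplus>\<^bsub>?A\<^esub> a = \<zero>\<^bsub>?A\<^esub>" if "a \<in> carrier ?A" for a
      using that by (intro bexI[of _ "- a"]) (auto simp: op_algebra_def uminus_in_nc_disk)
  qed (auto simp: op_algebra_def add.commute add.assoc nc_disk_closed_under)
  have "monoid ?A"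
    by (rule monoidI)
       (auto simp: op_algebra_def nc_disk_closed_under blinfun_compose_assoc intro!: blinfun_eqI)
  then have "ring ?A"
    by (intro ringI[OF ag]) (auto simp: op_algebra_def blinfun_compose_distrib)
  then show ?thesis
    by (rule complex_algebraI[OF ag])
       (auto simp: op_algebra_def scale_in_nc_disk op_scale_compose_left nc_disk_compose_scale
          ops.scale_right_distrib ops.scale_left_distrib)
qed

text \<open>The fibers inherit their algebra structure from \<open>nc_disk\<close> along the quotient map, so the
  axioms need not be checked on cosets.\<close>

lemma complex_algebra_hom_image:
  fixes A :: "(complex, 'a) module" and B :: "(complex, 'b) module"
  assumes A: "complex_algebra A" and carrier: "carrier B = q ` carrier A"
    and add: "\<And>a b. a \<in> carrier A \<Longrightarrow> b \<in> carrier A \<Longrightarrow> q a \<oplus>\<^bsub>B\<^esub> q b = q (a \<oplus>\<^bsub>A\<^esub> b)"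
    and mult: "\<And>a b. a \<in> carrier A \<Longrightarrow> b \<in> carrier A \<Longrightarrow> q a \<otimes>\<^bsub>B\<^esub> q b = q (a \<otimes>\<^bsub>A\<^esub> b)"
    and smult: "\<And>c a. a \<in> carrier A \<Longrightarrow> c \<odot>\<^bsub>B\<^esub> q a = q (c \<odot>\<^bsub>A\<^esub> a)"
    and one: "\<one>\<^bsub>B\<^esub> = q \<one>\<^bsub>A\<^esub>" and zero: "\<zero>\<^bsub>B\<^esub> = q \<zero>\<^bsub>A\<^esub>"
  shows "complex_algebra B"
proof -
  interpret A: complex_algebra A by (rule A)
  note hom = carrier add mult smult one zero
  have sc: "c \<odot>\<^bsub>A\<^esub> a \<in> carrier A" if "a \<in> carrier A" for c a
    using A.smult_closed[of c a] that by (simp add: complex_ring_def)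
  have ag: "abelian_group B"
  proof (rule abelian_groupI)
    show "\<exists>y\<in>carrier B. y \<oplus>\<^bsub>B\<^esub> x = \<zero>\<^bsub>B\<^esub>" if x: "x \<in> carrier B" for x
    proof -
      obtain a where a: "a \<in> carrier A" "x = q a" using x carrier by auto
      then show ?thesis
        by (intro bexI[of _ "q (\<ominus>\<^bsub>A\<^esub> a)"]) (auto simp: hom A.l_neg)
    qed
  qed (auto simp: hom A.a_ac)
  have mon: "monoid B"
    by (rule monoidI) (auto simp: hom A.m_assoc)
  have ring: "ring B"
    by (rule ringI[OF ag mon]) (auto simp: hom A.l_distr A.r_distr)
  show ?thesis
  proof (rule complex_algebraI[OF ag ring])
    fix c d :: complex and x
    assume "x \<in> carrier B"
    then obtain a where a: "a \<in> carrier A" "x = q a" using carrier by auto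
    show "c \<odot>\<^bsub>B\<^esub> x \<in> carrier B" using a by (auto simp: hom sc)
    show "(c + d) \<odot>\<^bsub>B\<^esub> x = c \<odot>\<^bsub>B\<^esub> x \<oplus>\<^bsub>B\<^esub> d \<odot>\<^bsub>B\<^esub> x"
      using a A.smult_l_distr[of c d a] by (simp add: hom sc complex_ring_def)
    show "(c * d) \<odot>\<^bsub>B\<^esub> x = c \<odot>\<^bsub>B\<^esub> (d \<odot>\<^bsub>B\<^esub> x)"
      using a A.smult_assoc1[of c d a] by (simp add: hom sc complex_ring_def)
    show "1 \<odot>\<^bsub>B\<^esub> x = x"
      using a A.smult_one[of a] by (simp add: hom sc complex_ring_def)
    fix y assume "y \<in> carrier B"
    then obtain b where b: "b \<in> carrier A" "y = q b" using carrier by auto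
    show "c \<odot>\<^bsub>B\<^esub> (x \<oplus>\<^bsub>B\<^esub> y) = c \<odot>\<^bsub>B\<^esub> x \<oplus>\<^bsub>B\<^esub> c \<odot>\<^bsub>B\<^esub> y"
      using a b A.smult_r_distr[of c a b] by (simp add: hom sc complex_ring_def)
    show "(c \<odot>\<^bsub>B\<^esub> x) \<otimes>\<^bsub>B\<^esub> y = c \<odot>\<^bsub>B\<^esub> (x \<otimes>\<^bsub>B\<^esub> y)"
      using a b A.smult_mult_left[of a b c] by (simp add: hom sc)
    show "x \<otimes>\<^bsub>B\<^esub> (c \<odot>\<^bsub>B\<^esub> y) = c \<odot>\<^bsub>B\<^esub> (x \<otimes>\<^bsub>B\<^esub> y)"
      using a b A.smult_mult_right[of a b c] by (simp add: hom sc)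
  qed
qed

section \<open>Closed ideals of the disk algebra\<close>

lemma disk_ideal_closed_under:
  fixes J :: "'d::finite fock_op set"
  assumes J: "ideal J (op_algebra nc_disk)"
  shows disk_ideal_subset: "J \<subseteq> nc_disk"
    and disk_ideal_mult_left: "a \<in> nc_disk \<Longrightarrow> j \<in> J \<Longrightarrow> a o\<^sub>L j \<in> J"
    and disk_ideal_mult_right: "a \<in> nc_disk \<Longrightarrow> j \<in> J \<Longrightarrow> j o\<^sub>L a \<in> J"
    and disk_ideal_subspace: "ops.subspace J"
proof -
  interpret ideal J "op_algebra nc_disk" by (rule J)
  show sub: "J \<subseteq> nc_disk" using a_subset by (simp add: op_algebra_def)
  show l: "a o\<^sub>L j \<in> J" if "a \<in> nc_disk" "j \<in> J" for a j
    using I_l_closed[of j a] that by (simp add: op_algebra_def)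
  show "j o\<^sub>L a \<in> J" if "a \<in> nc_disk" "j \<in> J" for a j
    using I_r_closed[of j a] that by (simp add: op_algebra_def)
  have "op_scale c j \<in> J" if "j \<in> J" for c j
  proof -
    \<comment> \<open>An ideal of a unital algebra is a complex subspace, as scalars act as multiples of the
        unit.\<close>
    have "op_scale c j = op_scale c id_blinfun o\<^sub>L j"
      by (auto intro!: blinfun_eqI simp: op_scale_apply)
    then show ?thesis using l[OF scale_in_nc_disk[OF one_in_nc_disk] that] by simp
  qed
  then show "ops.subspace J"
    using additive_subgroup.a_closed[OF is_additive_subgroup]
      additive_subgroup.zero_closed[OF is_additive_subgroup]
    by (auto simp: ops.subspace_def op_algebra_def)
qed

lemma subspace_if_ops_subspace: "ops.subspace J \<Longrightarrow> subspace J"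
  by (auto simp: ops.subspace_def subspace_def op_scale_of_real[symmetric])

lemma closure_graded_ideal:
  fixes I :: "'d::finite fock_op set"
  assumes I: "graded_ideal I"
  shows "ideal (closure I) (op_algebra nc_disk)"
proof (rule idealI)
  let ?A = "op_algebra (nc_disk :: 'd fock_op set)"
  have id: "ideal I (op_algebra nc_polys)" using I by (simp add: graded_ideal_def)
  interpret ideal I "op_algebra nc_polys" by (rule id)
  have I_left: "a o\<^sub>L j \<in> I" if "a \<in> nc_polys" "j \<in> I" for a j
    using I_l_closed[of j a] that by (simp add: op_algebra_def)
  have I_right: "j o\<^sub>L a \<in> I" if "a \<in> nc_polys" "j \<in> I" for a j
    using I_r_closed[of j a] that by (simp add: op_algebra_def)
  have sub: "ops.subspace I" by (rule graded_ideal_subspace[OF I])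
  have add: "a + b \<in> closure I" if "a \<in> closure I" "b \<in> closure I" for a b
    using that by (rule closure_binop[OF continuous_on_plus_pair _ closed_closure, rotated])
      (use closure_subset ops.subspace_add[OF sub] in blast)
  have left: "a o\<^sub>L b \<in> closure I" if "a \<in> nc_disk" "b \<in> closure I" for a b
    using that unfolding nc_disk_def
    by (rule closure_binop[OF continuous_on_compose_pair _ closed_closure, rotated])
      (use closure_subset I_left in blast)
  have right: "a o\<^sub>L b \<in> closure I" if "a \<in> closure I" "b \<in> nc_disk" for a b
    using that unfolding nc_disk_def
    by (rule closure_binop[OF continuous_on_compose_pair _ closed_closure, rotated])
      (use closure_subset I_right in blast)
  have clsub: "closure I \<subseteq> nc_disk"
    unfolding nc_disk_def by (rule closure_mono[OF graded_ideal_subset[OF I]])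
  have zero: "0 \<in> closure I" using ops.subspace_0[OF sub] closure_subset by blast
  have uminus: "- a \<in> closure I" if "a \<in> closure I" for a
  proof -
    have "- id_blinfun o\<^sub>L a = - a" by (rule blinfun_eqI) (simp add: uminus_blinfun.rep_eq)
    then show ?thesis using left[OF uminus_in_nc_disk[OF one_in_nc_disk] that] by simp
  qed
  interpret A: complex_algebra ?A by (rule complex_algebra_nc_disk)
  show "ring ?A" ..
  show "subgroup (closure I) (add_monoid ?A)"
  proof (rule subgroup.intro)
    show "inv\<^bsub>add_monoid ?A\<^esub> a \<in> closure I" if a: "a \<in> closure I" for a
    proof -
      have "\<ominus>\<^bsub>?A\<^esub> a = - a"
        by (rule A.minus_equality)
           (use a clsub in \<open>auto simp: op_algebra_def uminus_in_nc_disk\<close>)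
      then show ?thesis using uminus[OF a] by (simp add: a_inv_def)
    qed
  qed (use add zero clsub in \<open>auto simp: op_algebra_def\<close>)
  show "x \<otimes>\<^bsub>?A\<^esub> a \<in> closure I" if "a \<in> closure I" "x \<in> carrier ?A" for a x
    using left that by (simp add: op_algebra_def)
  show "a \<otimes>\<^bsub>?A\<^esub> x \<in> closure I" if "a \<in> closure I" "x \<in> carrier ?A" for a x
    using right that by (simp add: op_algebra_def)
qed

section \<open>Quotients of the disk algebra\<close>

abbreviation disk_coset :: "'d::finite fock_op set \<Rightarrow> 'd fock_op \<Rightarrow> 'd fock_op set" where
  "disk_coset J a \<equiv> J +>\<^bsub>op_algebra nc_disk\<^esub> a"

lemma disk_coset_eq: "disk_coset J a = (\<lambda>j. j + a) ` J"
  by (auto simp: a_r_coset_def' op_algebra_def)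

lemma disk_coset_eq_iff:
  assumes "ops.subspace J"
  shows "disk_coset J a = disk_coset J b \<longleftrightarrow> a - b \<in> J"
proof
  assume "disk_coset J a = disk_coset J b"
  moreover have "a \<in> disk_coset J a"
    using ops.subspace_0[OF assms] by (force simp: disk_coset_eq)
  ultimately show "a - b \<in> J" by (auto simp: disk_coset_eq)
next
  assume ab: "a - b \<in> J"
  have "disk_coset J x \<subseteq> disk_coset J y" if "x - y \<in> J" for x y
  proof
    fix z assume "z \<in> disk_coset J x"
    then obtain j where "j \<in> J" "z = j + x" by (auto simp: disk_coset_eq)
    then show "z \<in> disk_coset J y"
      using ops.subspace_add[OF assms \<open>j \<in> J\<close> that] by (auto simp: disk_coset_eq intro!: image_eqI[of _ _ "j + (x - y)"])
  qed
  moreover have "b - a \<in> J" using ops.subspace_neg[OF assms ab] by simp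
  ultimately show "disk_coset J a = disk_coset J b" using ab by blast
qed

lemma quot_norm_disk_coset:
  assumes "ops.subspace J"
  shows "quot_norm (disk_coset J a) = infdist a J"
proof -
  have "norm ` disk_coset J a = dist a ` J"
  proof
    show "norm ` disk_coset J a \<subseteq> dist a ` J"
    proof clarsimp
      fix z assume "z \<in> disk_coset J a"
      then obtain j where "j \<in> J" "z = j + a" by (auto simp: disk_coset_eq)
      then show "norm z \<in> dist a ` J"
        using ops.subspace_neg[OF assms] by (auto simp: dist_norm add.commute intro!: image_eqI[of _ _ "- j"])
    qed
    show "dist a ` J \<subseteq> norm ` disk_coset J a"
    proof clarsimp
      fix j assume "j \<in> J"
      then show "dist a j \<in> norm ` disk_coset J a"
        using ops.subspace_neg[OF assms]
        by (auto simp: dist_norm disk_coset_eq intro!: image_eqI[of _ _ "- j + a"])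
    qed
  qed
  then show ?thesis using ops.subspace_0[OF assms] by (auto simp: quot_norm_def infdist_def)
qed

lemma disk_quot_operations:
  fixes J :: "'d::finite fock_op set"
  assumes J: "ideal J (op_algebra nc_disk)"
  defines "Q \<equiv> quot_algebra (op_algebra nc_disk) J"
  shows carrier_disk_quot: "carrier Q = disk_coset J ` nc_disk"
    and add_disk_quot: "a \<in> nc_disk \<Longrightarrow> b \<in> nc_disk \<Longrightarrow> disk_coset J a \<oplus>\<^bsub>Q\<^esub> disk_coset J b = disk_coset J (a + b)"
    and mult_disk_quot: "a \<in> nc_disk \<Longrightarrow> b \<in> nc_disk \<Longrightarrow> disk_coset J a \<otimes>\<^bsub>Q\<^esub> disk_coset J b = disk_coset J (a o\<^sub>L b)"
    and smult_disk_quot: "a \<in> nc_disk \<Longrightarrow> c \<odot>\<^bsub>Q\<^esub> disk_coset J a = disk_coset J (op_scale c a)"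
    and one_disk_quot: "\<one>\<^bsub>Q\<^esub> = disk_coset J id_blinfun"
    and zero_disk_quot: "\<zero>\<^bsub>Q\<^esub> = disk_coset J 0"
proof -
  let ?A = "op_algebra (nc_disk :: 'd fock_op set)"
  interpret ideal J ?A by (rule J)
  note defs = Q_def quot_algebra_def ring.extend_def module.fields_def FactRing_def
  note A = op_algebra_def[of nc_disk]
  show "carrier Q = disk_coset J ` nc_disk"
    by (auto simp: defs A_RCOSETS_def' A)
  show "disk_coset J a \<oplus>\<^bsub>Q\<^esub> disk_coset J b = disk_coset J (a + b)" if "a \<in> nc_disk" "b \<in> nc_disk" for a b
    using a_rcos_sum[of a b] that by (simp add: defs) (simp add: A)
  show "disk_coset J a \<otimes>\<^bsub>Q\<^esub> disk_coset J b = disk_coset J (a o\<^sub>L b)" if "a \<in> nc_disk" "b \<in> nc_disk" for a b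
    using rcoset_mult_add[of a b] that by (simp add: defs) (simp add: A)
  show "\<one>\<^bsub>Q\<^esub> = disk_coset J id_blinfun" by (simp add: defs) (simp add: A)
  show "\<zero>\<^bsub>Q\<^esub> = disk_coset J 0" by (simp add: defs disk_coset_eq)
  note sub = disk_ideal_subspace[OF J]
  show "c \<odot>\<^bsub>Q\<^esub> disk_coset J a = disk_coset J (op_scale c a)" if "a \<in> nc_disk" for a c
  proof -
    have "disk_coset J (op_scale c b) = disk_coset J (op_scale c a)" if "b \<in> disk_coset J a" for b
    proof -
      have "b - a \<in> J" using that by (auto simp: disk_coset_eq)
      then have "op_scale c (b - a) \<in> J" by (rule ops.subspace_scale[OF sub])
      then show ?thesis by (simp add: disk_coset_eq_iff[OF sub] ops.scale_right_diff_distrib)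
    qed
    moreover have "a \<in> disk_coset J a"
      using ops.subspace_0[OF sub] by (force simp: disk_coset_eq)
    ultimately have "(\<Union>b\<in>disk_coset J a. disk_coset J (op_scale c b)) = disk_coset J (op_scale c a)"
      by blast
    then show ?thesis by (simp add: defs) (simp add: A)
  qed
qed

section \<open>The quotient norm\<close>

lemma infdist_op_scale:
  assumes J: "ops.subspace J"
  shows "infdist (op_scale c a) J = cmod c * infdist a J"
proof -
  have ne: "J \<noteq> {}" using ops.subspace_0[OF J] by auto
  have le: "infdist (op_scale c a) J \<le> cmod c * infdist a J" if c0: "c \<noteq> 0" for c a
  proof (rule field_le_epsilon)
    fix e :: real assume e: "e > 0"
    obtain j where j: "j \<in> J" "dist a j < infdist a J + e / cmod c"
      by (rule infdist_approx[OF ne, of "e / cmod c" a]) (use e c0 in auto)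
    have "infdist (op_scale c a) J \<le> dist (op_scale c a) (op_scale c j)"
      by (rule infdist_le[OF ops.subspace_scale[OF J j(1)]])
    also have "\<dots> = cmod c * dist a j"
      by (simp add: dist_norm ops.scale_right_diff_distrib[symmetric] norm_op_scale)
    also have "\<dots> \<le> cmod c * (infdist a J + e / cmod c)" using j by (intro mult_left_mono) auto
    finally show "infdist (op_scale c a) J \<le> cmod c * infdist a J + e"
      using c0 by (simp add: distrib_left)
  qed
  show ?thesis
  proof (cases "c = 0")
    case True
    then show ?thesis using ops.subspace_0[OF J] by simp
  next
    case False
    have "infdist a J \<le> cmod (inverse c) * infdist (op_scale c a) J"
      using le[of "inverse c" "op_scale c a"] False by simp
    then have "cmod c * infdist a J \<le> cmod c * (cmod (inverse c) * infdist (op_scale c a) J)"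
      by (rule mult_left_mono) simp
    then have "cmod c * infdist a J \<le> infdist (op_scale c a) J"
      using False by (simp add: norm_inverse mult.assoc[symmetric])
    then show ?thesis using le[OF False, of a] by simp
  qed
qed

lemma infdist_compose_le:
  fixes J :: "'d::finite fock_op set"
  assumes J: "ideal J (op_algebra nc_disk)" and a: "a \<in> nc_disk" and b: "b \<in> nc_disk"
  shows "infdist (a o\<^sub>L b) J \<le> infdist a J * infdist b J"
proof -
  note sub = disk_ideal_subspace[OF J]
  have ne: "J \<noteq> {}" using ops.subspace_0[OF sub] by auto
  have *: "infdist (a o\<^sub>L b) J \<le> (infdist a J + e) * (infdist b J + e)" if e: "e > 0" for e
  proof -
    obtain i where i: "i \<in> J" "dist a i < infdist a J + e"
      by (rule infdist_approx[OF ne e])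
    obtain j where j: "j \<in> J" "dist b j < infdist b J + e"
      by (rule infdist_approx[OF ne e])
    have "(i o\<^sub>L (b - j)) + (a o\<^sub>L j) \<in> J"
      using a b i j disk_ideal_subset[OF J]
      by (intro ops.subspace_add[OF sub] disk_ideal_mult_left[OF J] disk_ideal_mult_right[OF J]
          diff_in_nc_disk) auto
    then have "infdist (a o\<^sub>L b) J \<le> dist (a o\<^sub>L b) ((i o\<^sub>L (b - j)) + (a o\<^sub>L j))"
      by (rule infdist_le)
    also have "\<dots> = norm ((a - i) o\<^sub>L (b - j))"
    proof -
      have "(a o\<^sub>L b) - ((i o\<^sub>L (b - j)) + (a o\<^sub>L j)) = (a - i) o\<^sub>L (b - j)"
        by (rule blinfun_eqI) (simp add: minus_blinfun.rep_eq plus_blinfun.rep_eq blinfun.diff_right)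
      then show ?thesis by (simp add: dist_norm)
    qed
    also have "\<dots> \<le> norm (a - i) * norm (b - j)" by (rule norm_blinfun_compose)
    also have "\<dots> \<le> (infdist a J + e) * (infdist b J + e)"
      using i j e by (intro mult_mono) (auto simp: dist_norm infdist_nonneg intro!: add_nonneg_nonneg)
    finally show ?thesis .
  qed
  have "((\<lambda>e. (infdist a J + e) * (infdist b J + e)) \<longlongrightarrow> (infdist a J + 0) * (infdist b J + 0)) (at_right 0)"
    by (intro tendsto_intros)
  then have "infdist (a o\<^sub>L b) J \<le> (infdist a J + 0) * (infdist b J + 0)"
    by (rule tendsto_lowerbound) (auto intro!: * eventually_at_right_less[THEN eventually_mono])
  then show ?thesis by simp
qed

text \<open>Completeness of the quotient seminorm, by the usual argument: representatives of a rapidly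
  convergent subsequence can be corrected by elements of \<open>J\<close> so that they converge in norm.\<close>

lemma infdist_cauchy_limit:
  fixes u :: "nat \<Rightarrow> 'a::banach"
  assumes J: "subspace J" and C: "subspace C" "closed C" "J \<subseteq> C" and uC: "\<And>n. u n \<in> C"
    and cauchy: "\<And>e. e > 0 \<Longrightarrow> \<exists>N. \<forall>m\<ge>N. \<forall>n\<ge>N. infdist (u m - u n) J < e"
  shows "\<exists>l\<in>C. (\<lambda>n. infdist (u n - l) J) \<longlonglongrightarrow> 0"
proof -
  have ne: "J \<noteq> {}" using subspace_0[OF J] by auto
  have "\<exists>N. \<forall>m\<ge>N. \<forall>n\<ge>N. infdist (u m - u n) J < (1 / 2) ^ k" for k :: nat
    by (rule cauchy) simp
  then obtain N where N: "\<And>k m n. m \<ge> N k \<Longrightarrow> n \<ge> N k \<Longrightarrow> infdist (u m - u n) J < (1 / 2) ^ k"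
    by metis
  define M where "M k = (\<Sum>i\<le>k. N i)" for k
  have M: "N k \<le> M k" "M k \<le> M (Suc k)" for k
    by (auto simp: M_def member_le_sum)
  have "\<exists>j\<in>J. dist (u (M (Suc k)) - u (M k)) j < (1 / 2) ^ k" for k
  proof -
    have "infdist (u (M (Suc k)) - u (M k)) J < (1 / 2) ^ k"
      using M[of k] by (intro N) auto
    then show ?thesis
      using infdist_approx[OF ne, of "(1 / 2) ^ k - infdist (u (M (Suc k)) - u (M k)) J"
          "u (M (Suc k)) - u (M k)"] by auto
  qed
  then obtain j where j: "\<And>k. j k \<in> J" "\<And>k. dist (u (M (Suc k)) - u (M k)) (j k) < (1 / 2) ^ k"
    by metis
  \<comment> \<open>The corrections \<open>j k\<close> are accumulated in \<open>s\<close>, so consecutive terms of \<open>v\<close> differ by less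
      than \<open>(1 / 2) ^ k\<close>.\<close>
  define s where "s k = (\<Sum>i<k. j i)" for k
  define v where "v k = u (M k) - s k" for k
  have sJ: "s k \<in> J" for k unfolding s_def by (rule subspace_sum[OF J]) (rule j)
  have "summable (\<lambda>k. v (Suc k) - v k)"
  proof (rule summable_comparison_test'[where N = 0])
    show "summable (\<lambda>k. (1 / 2 :: real) ^ k)" by (rule summable_geometric) simp
    show "norm (v (Suc k) - v k) \<le> (1 / 2) ^ k" for k
      using j(2)[of k] by (simp add: v_def s_def dist_norm algebra_simps)
  qed
  then have "(\<lambda>k. v 0 + (\<Sum>i<k. v (Suc i) - v i)) \<longlonglongrightarrow> v 0 + (\<Sum>i. v (Suc i) - v i)"
    by (intro tendsto_intros summable_LIMSEQ)
  then obtain l where l: "v \<longlonglongrightarrow> l" by (simp add: sum_lessThan_telescope)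
  have vC: "v k \<in> C" for k
    unfolding v_def using C(3) sJ uC by (intro subspace_diff[OF C(1)]) auto
  have lC: "l \<in> C" using closed_sequentially[OF C(2) vC l] .
  have "(\<lambda>n. infdist (u n - l) J) \<longlonglongrightarrow> 0"
  proof (rule LIMSEQ_I)
    fix e :: real assume e: "e > 0"
    have pow: "(\<lambda>k. (1 / 2 :: real) ^ k) \<longlonglongrightarrow> 0" by (rule LIMSEQ_power_zero) simp
    have "eventually (\<lambda>k. dist (v k) l < e / 2 \<and> (1 / 2 :: real) ^ k < e / 2) sequentially"
      using tendstoD[OF l, of "e / 2"] order_tendstoD(2)[OF pow, of "e / 2"] e
      by (intro eventually_conj) auto
    then obtain k where k: "dist (v k) l < e / 2" "(1 / 2 :: real) ^ k < e / 2"
      using eventually_happens by force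
    have "infdist (u n - l) J < e" if n: "n \<ge> M k" for n
    proof -
      have "infdist (u (M k) - l) J \<le> dist (u (M k) - l) (s k)" by (rule infdist_le[OF sJ])
      also have "\<dots> = dist (v k) l" by (simp add: v_def dist_norm algebra_simps)
      finally have "infdist (u (M k) - l) J < e / 2" using k by simp
      moreover have "infdist (u n - u (M k)) J < (1 / 2) ^ k"
        using M(1)[of k] n by (intro N) auto
      ultimately show ?thesis
        using infdist_add_le[OF J, of "u n - u (M k)" "u (M k) - l"] k by simp
    qed
    then show "\<exists>n0. \<forall>n\<ge>n0. norm (infdist (u n - l) J - 0) < e"
      by (auto simp: infdist_nonneg)
  qed
  with lC show ?thesis by blast
qed

instance ell2 :: (type) banach ..

section \<open>The bundle of a continuous field of closed ideals\<close>

lemma continuous_map_realI: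
  fixes f :: "'a \<Rightarrow> real"
  assumes "\<And>x e. x \<in> topspace X \<Longrightarrow> e > 0 \<Longrightarrow>
    \<exists>U. openin X U \<and> x \<in> U \<and> (\<forall>y\<in>U. \<bar>f y - f x\<bar> < e)"
  shows "continuous_map X euclideanreal f"
  unfolding continuous_map_def
proof (intro conjI allI impI)
  fix V :: "real set" assume V: "openin euclideanreal V"
  show "openin X {x \<in> topspace X. f x \<in> V}"
  proof (subst openin_subopen, clarify)
    fix x assume x: "x \<in> topspace X" "f x \<in> V"
    then obtain e where e: "e > 0" "\<And>r. \<bar>r - f x\<bar> < e \<Longrightarrow> r \<in> V"
      using V by (auto simp: open_dist dist_real_def)
    obtain U where "openin X U" "x \<in> U" "\<forall>y\<in>U. \<bar>f y - f x\<bar> < e"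
      using assms[OF x(1) e(1)] by blast
    then show "\<exists>T. openin X T \<and> x \<in> T \<and> T \<subseteq> {x \<in> topspace X. f x \<in> V}"
      using e openin_subset by (intro exI[of _ U]) blast
  qed
qed simp

lemma continuous_map_top_of_set_binop:
  assumes "continuous_on UNIV (\<lambda>p. f (fst p) (snd p))"
    and "\<And>a b. a \<in> S \<Longrightarrow> b \<in> T \<Longrightarrow> f a b \<in> C"
  shows "continuous_map (prod_topology (top_of_set S) (top_of_set T)) (top_of_set C)
    (\<lambda>p. f (fst p) (snd p))"
proof -
  have "continuous_on (S \<times> T) (\<lambda>p. f (fst p) (snd p))"
    using assms(1) by (rule continuous_on_subset) simp
  then show ?thesis
    using assms(2) by (auto simp: continuous_map_in_subtopology)
qed

text \<open>All that the construction uses about the ideals: they are closed two-sided ideals, and the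
  quotient norm of each fixed element varies continuously.\<close>

locale disk_ideal_field =
  fixes X :: "'x topology" and J :: "'x \<Rightarrow> 'd::finite fock_op set"
  assumes ideal: "x \<in> topspace X \<Longrightarrow> ideal (J x) (op_algebra nc_disk)"
    and closed: "x \<in> topspace X \<Longrightarrow> closed (J x)"
    and infdist_continuous: "a \<in> nc_disk \<Longrightarrow> continuous_map X euclideanreal (\<lambda>x. infdist a (J x))"
begin

abbreviation quotient_at :: "'x \<Rightarrow> (complex, 'd fock_op set) module" where
  "quotient_at x \<equiv> quot_algebra (op_algebra nc_disk) (J x)"

text \<open>The quotient algebra with its elements tagged by the base point, which makes the fibers
  disjoint.\<close>

definition fiber :: "'x \<Rightarrow> (complex, 'x \<times> 'd fock_op set) module" where
  "fiber x = \<lparr>carrier = {x} \<times> carrier (quotient_at x),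
     mult = (\<lambda>e e'. (x, snd e \<otimes>\<^bsub>quotient_at x\<^esub> snd e')), one = (x, \<one>\<^bsub>quotient_at x\<^esub>),
     zero = (x, \<zero>\<^bsub>quotient_at x\<^esub>), add = (\<lambda>e e'. (x, snd e \<oplus>\<^bsub>quotient_at x\<^esub> snd e')),
     smult = (\<lambda>c e. (x, c \<odot>\<^bsub>quotient_at x\<^esub> snd e))\<rparr>"

definition total_class :: "'x \<times> 'd fock_op \<Rightarrow> 'x \<times> 'd fock_op set" where
  "total_class p = (fst p, disk_coset (J (fst p)) (snd p))"

definition total_norm :: "'x \<times> 'd fock_op set \<Rightarrow> real" where
  "total_norm e = quot_norm (snd e)"

abbreviation pre_total :: "('x \<times> 'd fock_op) topology" where
  "pre_total \<equiv> prod_topology X (top_of_set nc_disk)"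

text \<open>The quotient topology along \<open>total_class\<close>.\<close>

definition total :: "('x \<times> 'd fock_op set) topology" where
  "total = topology (\<lambda>W. W \<subseteq> total_class ` topspace pre_total \<and>
     openin pre_total {p \<in> topspace pre_total. total_class p \<in> W})"

lemma fst_total_class [simp]: "fst (total_class p) = fst p"
  by (simp add: total_class_def)

lemma subspace_J: "x \<in> topspace X \<Longrightarrow> ops.subspace (J x)"
  by (rule disk_ideal_subspace[OF ideal])

lemma total_class_eq_iff:
  "x \<in> topspace X \<Longrightarrow> total_class (x, a) = total_class (x, b) \<longleftrightarrow> a - b \<in> J x"
  by (simp add: total_class_def disk_coset_eq_iff subspace_J)

lemma total_norm_class: "x \<in> topspace X \<Longrightarrow> total_norm (total_class (x, a)) = infdist a (J x)"
  by (simp add: total_norm_def total_class_def quot_norm_disk_coset subspace_J)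

lemma openin_total:
  "openin total W \<longleftrightarrow> W \<subseteq> total_class ` topspace pre_total \<and>
     openin pre_total {p \<in> topspace pre_total. total_class p \<in> W}"
proof -
  have "istopology (\<lambda>W. W \<subseteq> total_class ` topspace pre_total \<and>
      openin pre_total {p \<in> topspace pre_total. total_class p \<in> W})"
    (is "istopology ?L")
    unfolding istopology_def
  proof (intro conjI allI impI)
    fix S T assume ST: "?L S" "?L T"
    then show "S \<inter> T \<subseteq> total_class ` topspace pre_total" by blast
    have "{p \<in> topspace pre_total. total_class p \<in> S \<inter> T}
        = {p \<in> topspace pre_total. total_class p \<in> S} \<inter> {p \<in> topspace pre_total. total_class p \<in> T}"
      by auto
    then show "openin pre_total {p \<in> topspace pre_total. total_class p \<in> S \<inter> T}"
      using ST by (simp only: openin_Int)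
  next
    fix K assume K: "\<forall>S\<in>K. ?L S"
    then show "\<Union>K \<subseteq> total_class ` topspace pre_total" by blast
    have "{p \<in> topspace pre_total. total_class p \<in> \<Union>K}
        = (\<Union>S\<in>K. {p \<in> topspace pre_total. total_class p \<in> S})" by auto
    moreover have "openin pre_total (\<Union>S\<in>K. {p \<in> topspace pre_total. total_class p \<in> S})"
      using K by (intro openin_Union) blast
    ultimately show "openin pre_total {p \<in> topspace pre_total. total_class p \<in> \<Union>K}"
      by (simp only:)
  qed
  then show ?thesis by (simp add: total_def)
qed

lemma topspace_total: "topspace total = total_class ` topspace pre_total"
proof -
  have "{p \<in> topspace pre_total. total_class p \<in> total_class ` topspace pre_total}
      = topspace pre_total" by auto
  then have "openin total (total_class ` topspace pre_total)"
    unfolding openin_total by (simp only: openin_topspace order_refl simp_thms)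
  then show ?thesis
    using openin_total[of "topspace total"] openin_subset[of total "total_class ` topspace pre_total"]
    by (meson openin_topspace subset_antisym)
qed

lemma quotient_map_total_class: "quotient_map pre_total total total_class"
  unfolding quotient_map_def topspace_total openin_total by auto

lemma continuous_total_class: "continuous_map pre_total total total_class"
  by (rule quotient_imp_continuous_map[OF quotient_map_total_class])

text \<open>If \<open>a\<close> and \<open>a'\<close> have the same class at \<open>x\<close> then \<open>c = a' - a\<close> has distance 0 from \<open>J x\<close>,
  hence small distance from \<open>J y\<close> for \<open>y\<close> near \<open>x\<close>. So any \<open>b\<close> near \<open>a\<close> has, at \<open>y\<close>, the same
  class as some \<open>b + j\<close> near \<open>a'\<close>.\<close>

lemma open_map_total_class: "open_map pre_total total total_class"
  unfolding open_map_def
proof (intro allI impI)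
  fix S assume S: "openin pre_total S"
  then have S_sub: "S \<subseteq> topspace pre_total" by (rule openin_subset)
  have "openin pre_total {p \<in> topspace pre_total. total_class p \<in> total_class ` S}"
    unfolding openin_prod_topology_alt
  proof (intro allI impI)
    fix x a assume "(x, a) \<in> {p \<in> topspace pre_total. total_class p \<in> total_class ` S}"
    then obtain a' where x: "x \<in> topspace X" and a: "a \<in> nc_disk" and a': "(x, a') \<in> S"
      and eq: "total_class (x, a) = total_class (x, a')"
      by (auto simp: total_class_def)
    have a'_in: "a' \<in> nc_disk" using a' S_sub by auto
    obtain U V where U: "openin X U" "x \<in> U" and V: "openin (top_of_set nc_disk) V" "a' \<in> V"
      and UV: "U \<times> V \<subseteq> S"
      using S a' unfolding openin_prod_topology_alt by meson
    obtain e where e: "e > 0" "ball a' e \<inter> nc_disk \<subseteq> V"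
      using V by (auto simp: openin_contains_ball)
    define c where "c = a' - a"
    have c: "c \<in> nc_disk" by (simp add: c_def diff_in_nc_disk a a'_in)
    have "c \<in> J x" using eq total_class_eq_iff[OF x] by (metis c_def)
    define U' where "U' = {y \<in> topspace X. infdist c (J y) \<in> {..<e / 2}}"
    have U'_open: "openin X U'"
      unfolding U'_def by (rule openin_continuous_map_preimage[OF infdist_continuous[OF c]]) simp
    have UU': "openin X (U \<inter> U')" by (rule openin_Int[OF U(1) U'_open])
    have "x \<in> U'" using x e \<open>c \<in> J x\<close> by (simp add: U'_def)
    have "total_class (y, b) \<in> total_class ` S"
      if y: "y \<in> U \<inter> U'" and b: "b \<in> ball a (e / 2) \<inter> nc_disk" for y b
    proof -
      have yX: "y \<in> topspace X" and "infdist c (J y) < e / 2" using y by (auto simp: U'_def)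
      moreover have "J y \<noteq> {}" using ops.subspace_0[OF subspace_J[OF yX]] by auto
      ultimately obtain j where j: "j \<in> J y" "dist c j < e / 2"
        using infdist_approx[of "J y" "e / 2 - infdist c (J y)" c] by auto
      have "dist a' (b + j) = norm ((a - b) + (c - j))" by (simp add: dist_norm c_def algebra_simps)
      also have "\<dots> \<le> dist a b + dist c j" unfolding dist_norm by (rule norm_triangle_ineq)
      also have "\<dots> < e" using b j by simp
      finally have "b + j \<in> V"
        using e b j disk_ideal_subset[OF ideal[OF yX]] by (auto intro!: add_in_nc_disk subsetD[OF e(2)])
      then have "(y, b + j) \<in> S" using UV y by auto
      moreover have "total_class (y, b) = total_class (y, b + j)"
        unfolding total_class_eq_iff[OF yX] using ops.subspace_neg[OF subspace_J[OF yX] j(1)] by simp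
      ultimately show ?thesis by auto
    qed
    then have "(U \<inter> U') \<times> (ball a (e / 2) \<inter> nc_disk)
        \<subseteq> {p \<in> topspace pre_total. total_class p \<in> total_class ` S}"
      by (auto simp: U'_def)
    moreover have "openin (top_of_set nc_disk) (ball a (e / 2) \<inter> nc_disk)"
      using openin_open_Int[of "ball a (e / 2)" nc_disk] by (simp add: Int_commute)
    ultimately show "\<exists>U V. openin X U \<and> openin (top_of_set nc_disk) V \<and> x \<in> U \<and> a \<in> V \<and>
        U \<times> V \<subseteq> {p \<in> topspace pre_total. total_class p \<in> total_class ` S}"
      using UU' \<open>x \<in> U\<close> \<open>x \<in> U'\<close> a e
      by (intro exI[of _ "U \<inter> U'"] exI[of _ "ball a (e / 2) \<inter> nc_disk"]) simp
  qed
  then show "openin total (total_class ` S)"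
    unfolding openin_total using S_sub by blast
qed

lemma total_norm_continuous: "continuous_map total euclideanreal total_norm"
proof -
  have "continuous_map pre_total euclideanreal (\<lambda>p. infdist (snd p) (J (fst p)))"
  proof (rule continuous_map_realI, clarsimp)
    fix x and a :: "'d fock_op" and e :: real assume x: "x \<in> topspace X" and a: "a \<in> nc_disk" and e: "e > 0"
    define U where "U = {y \<in> topspace X. infdist a (J y) \<in> {infdist a (J x) - e / 2 <..< infdist a (J x) + e / 2}}"
    have U: "openin X U"
      unfolding U_def by (rule openin_continuous_map_preimage[OF infdist_continuous[OF a]]) simp
    have V: "openin (top_of_set nc_disk) (ball a (e / 2) \<inter> nc_disk)"
      using openin_open_Int[of "ball a (e / 2)" nc_disk] by (simp add: Int_commute)
    have "\<bar>infdist b (J y) - infdist a (J x)\<bar> < e"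
      if "y \<in> U" "b \<in> ball a (e / 2)" for y b
      using that infdist_triangle_abs[of b "J y" a] by (auto simp: U_def dist_commute)
    then show "\<exists>W. openin pre_total W \<and> (x, a) \<in> W \<and>
        (\<forall>p\<in>W. \<bar>infdist (snd p) (J (fst p)) - infdist a (J x)\<bar> < e)"
      using U V x a e
      by (intro exI[of _ "U \<times> (ball a (e / 2) \<inter> nc_disk)"])
         (auto simp: openin_prod_Times_iff U_def)
  qed
  then have "continuous_map pre_total euclideanreal (total_norm \<circ> total_class)"
    by (rule continuous_map_eq) (auto simp: total_norm_class)
  then show ?thesis
    using continuous_compose_quotient_map_eq[OF quotient_map_total_class] by blast
qed

lemma fst_continuous: "continuous_map total X fst"
proof -
  have "continuous_map pre_total X (fst \<circ> total_class)"
    by (rule continuous_map_eq[OF continuous_map_fst]) simp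
  then show ?thesis
    using continuous_compose_quotient_map_eq[OF quotient_map_total_class] by blast
qed

lemma fst_open: "open_map total X fst"
  unfolding open_map_def
proof (intro allI impI)
  fix W assume W: "openin total W"
  have "fst ` W = fst ` {p \<in> topspace pre_total. total_class p \<in> W}"
  proof (intro equalityI subsetI)
    fix x assume "x \<in> fst ` W"
    then obtain p where "p \<in> topspace pre_total" "total_class p \<in> W" "x = fst p"
      using W unfolding openin_total by fastforce
    then show "x \<in> fst ` {p \<in> topspace pre_total. total_class p \<in> W}" by blast
  qed (force simp: total_class_def)
  moreover have "openin X (fst ` {p \<in> topspace pre_total. total_class p \<in> W})"
    using W open_map_fst[of X "top_of_set (nc_disk :: 'd fock_op set)"]
    unfolding openin_total open_map_def by blast
  ultimately show "openin X (fst ` W)" by (simp only:)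
qed

text \<open>The images of open boxes under the open map \<open>total_class\<close> provide the neighbourhoods in the
  fiber product; two points of such images over the same \<open>y\<close> have representatives in the boxes.\<close>

lemma binop_continuous:
  assumes f: "continuous_map (prod_topology (top_of_set nc_disk) (top_of_set nc_disk)) (top_of_set nc_disk)
      (\<lambda>p. f (fst p) (snd p))"
    and g: "\<And>x a b. x \<in> topspace X \<Longrightarrow> a \<in> nc_disk \<Longrightarrow> b \<in> nc_disk \<Longrightarrow>
      g (total_class (x, a)) (total_class (x, b)) = total_class (x, f a b)"
  shows "continuous_map (subtopology (prod_topology total total) {(e, e'). fst e = fst e'}) total
      (\<lambda>(e, e'). g e e')"
proof -
  let ?A = "top_of_set (nc_disk :: 'd fock_op set)"
  let ?D = "{(e :: 'x \<times> 'd fock_op set, e' :: 'x \<times> 'd fock_op set). fst e = fst e'}"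
  let ?S = "subtopology (prod_topology total total) ?D"
  have closed: "f a b \<in> nc_disk" if "a \<in> nc_disk" "b \<in> nc_disk" for a b
    using continuous_map_image_subset_topspace[OF f] that by (simp add: image_subset_iff)
  have pt: "\<exists>x a b. x \<in> topspace X \<and> a \<in> nc_disk \<and> b \<in> nc_disk \<and>
      p = (total_class (x, a), total_class (x, b))" if p: "p \<in> topspace ?S" for p
    using p by (auto simp: topspace_total topspace_subtopology) (metis SigmaI)
  have "openin ?S {p \<in> topspace ?S. (case p of (e, e') \<Rightarrow> g e e') \<in> W}" if W: "openin total W" for W
  proof (subst openin_subopen, intro ballI)
    fix p assume p: "p \<in> {p \<in> topspace ?S. (case p of (e, e') \<Rightarrow> g e e') \<in> W}"
    then obtain x a b where x: "x \<in> topspace X" and a: "a \<in> nc_disk" and b: "b \<in> nc_disk"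
      and p_eq: "p = (total_class (x, a), total_class (x, b))" using pt by blast
    let ?Z = "prod_topology X (prod_topology ?A ?A)"
    let ?h = "\<lambda>q. total_class (fst q, f (fst (snd q)) (snd (snd q)))"
    have "continuous_map ?Z pre_total (\<lambda>q. (fst q, f (fst (snd q)) (snd (snd q))))"
      by (intro continuous_map_pairedI continuous_map_fst
          continuous_map_compose[OF continuous_map_snd f, unfolded o_def])
    then have "continuous_map ?Z total ?h"
      using continuous_map_compose[OF _ continuous_total_class] by (force simp: o_def)
    then have "openin ?Z {q \<in> topspace ?Z. ?h q \<in> W}"
      using W by (rule openin_continuous_map_preimage)
    moreover have "(x, (a, b)) \<in> {q \<in> topspace ?Z. ?h q \<in> W}"
      using p x a b g[OF x a b] by (simp add: p_eq)
    ultimately obtain U V where U: "openin X U" "x \<in> U"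
      and V: "openin (prod_topology ?A ?A) V" "(a, b) \<in> V" and UV: "U \<times> V \<subseteq> {q \<in> topspace ?Z. ?h q \<in> W}"
      unfolding openin_prod_topology_alt[of X] by meson
    obtain V1 V2 where V12: "openin ?A V1" "openin ?A V2" "a \<in> V1" "b \<in> V2" "V1 \<times> V2 \<subseteq> V"
      using V unfolding openin_prod_topology_alt by meson
    define T where "T = (total_class ` (U \<times> V1)) \<times> (total_class ` (U \<times> V2)) \<inter> ?D"
    have open_image: "openin total (total_class ` (U \<times> V'))" if "openin ?A V'" for V'
      using open_map_total_class U that unfolding open_map_def
      by (simp add: openin_prod_Times_iff)
    have T_open: "openin ?S T"
      unfolding T_def
      by (intro openin_subtopology_Int) (simp add: openin_prod_Times_iff open_image V12)
    have "p \<in> T" using U V12 by (auto simp: T_def p_eq)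
    moreover have "T \<subseteq> {p \<in> topspace ?S. (case p of (e, e') \<Rightarrow> g e e') \<in> W}"
    proof
      fix q assume q: "q \<in> T"
      then obtain y a' b' where y: "y \<in> U" and ab': "a' \<in> V1" "b' \<in> V2"
        and q_eq: "q = (total_class (y, a'), total_class (y, b'))"
        by (auto simp: T_def)
      have "(y, (a', b')) \<in> U \<times> V" using y ab' V12 by auto
      then have "y \<in> topspace X" "a' \<in> nc_disk" "b' \<in> nc_disk" "total_class (y, f a' b') \<in> W"
        using UV by auto
      then have "(case q of (e, e') \<Rightarrow> g e e') \<in> W" by (simp add: q_eq g)
      moreover have "q \<in> topspace ?S" using openin_subset[OF T_open] q by blast
      ultimately show "q \<in> {p \<in> topspace ?S. (case p of (e, e') \<Rightarrow> g e e') \<in> W}" by simp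
    qed
    ultimately show "\<exists>T. openin ?S T \<and> p \<in> T \<and>
        T \<subseteq> {p \<in> topspace ?S. (case p of (e, e') \<Rightarrow> g e e') \<in> W}"
      using T_open by blast
  qed
  moreover have "(case p of (e, e') \<Rightarrow> g e e') \<in> topspace total" if "p \<in> topspace ?S" for p
    using pt[OF that] by (auto simp: g closed topspace_total)
  ultimately show ?thesis by (auto simp: continuous_map_def)
qed

text \<open>The product of \<open>total_class\<close> with the identity of the scalars is again an open quotient map,
  so continuity can be tested before passing to the quotient.\<close>

lemma smult_total_continuous:
  assumes g: "\<And>x a c. x \<in> topspace X \<Longrightarrow> a \<in> nc_disk \<Longrightarrow>
      g (total_class (x, a)) c = total_class (x, op_scale c a)"
  shows "continuous_map (prod_topology total euclidean) total (\<lambda>(e, c). g e c)"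
proof -
  let ?A = "top_of_set (nc_disk :: 'd fock_op set)"
  let ?q = "\<lambda>p :: ('x \<times> 'd fock_op) \<times> complex. (total_class (fst p), snd p)"
  let ?Z = "prod_topology pre_total (euclidean :: complex topology)"
  let ?S = "prod_topology total (euclidean :: complex topology)"
  have "continuous_map (prod_topology ?A (euclidean :: complex topology)) ?A (\<lambda>p. op_scale (snd p) (fst p))"
  proof -
    have "continuous_on UNIV (\<lambda>p :: 'd fock_op \<times> complex. op_scale (snd p) (fst p))"
      by (intro bounded_bilinear.continuous_on[OF bounded_bilinear_op_scale] continuous_intros)
    then have "continuous_map (prod_topology ?A (top_of_set UNIV)) ?A (\<lambda>p. op_scale (snd p) (fst p))"
      by (rule continuous_map_top_of_set_binop) (rule scale_in_nc_disk)
    then show ?thesis by (simp only: subtopology_UNIV)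
  qed
  note scale = this
  have "continuous_map ?Z pre_total (\<lambda>p. (fst (fst p), op_scale (snd p) (snd (fst p))))"
  proof (intro continuous_map_pairedI)
    show "continuous_map ?Z X (\<lambda>p. fst (fst p))"
      using continuous_map_compose[OF continuous_map_fst continuous_map_fst] by (simp add: o_def)
    have "continuous_map ?Z ?A (\<lambda>p. snd (fst p))"
      using continuous_map_compose[OF continuous_map_fst continuous_map_snd] by (simp add: o_def)
    then have "continuous_map ?Z (prod_topology ?A euclidean) (\<lambda>p. (snd (fst p), snd p))"
      by (intro continuous_map_pairedI continuous_map_snd)
    from continuous_map_compose[OF this scale]
    show "continuous_map ?Z ?A (\<lambda>p. op_scale (snd p) (snd (fst p)))" by (simp add: o_def)
  qed
  from continuous_map_compose[OF this continuous_total_class]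
  have "continuous_map ?Z total (\<lambda>p. total_class (fst (fst p), op_scale (snd p) (snd (fst p))))"
    by (simp add: o_def)
  then have "continuous_map ?Z total ((\<lambda>(e, c). g e c) \<circ> ?q)"
    by (rule continuous_map_eq) (auto simp: g)
  moreover have "quotient_map ?Z ?S ?q"
  proof (rule continuous_open_imp_quotient_map)
    show "continuous_map ?Z ?S ?q"
      by (intro continuous_map_pairedI continuous_map_snd
          continuous_map_compose[OF continuous_map_fst continuous_total_class, unfolded o_def])
    show "open_map ?Z ?S ?q"
      unfolding open_map_def
    proof (intro allI impI)
      fix W assume W: "openin ?Z W"
      show "openin ?S (?q ` W)"
        unfolding openin_prod_topology_alt
      proof (intro allI impI)
        fix e c assume "(e, c) \<in> ?q ` W"
        then obtain p where p: "(p, c) \<in> W" "e = total_class p" by auto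
        then obtain U V where UV: "openin pre_total U" "openin euclidean V" "p \<in> U" "c \<in> V" "U \<times> V \<subseteq> W"
          using W unfolding openin_prod_topology_alt[of pre_total] by meson
        then have "openin total (total_class ` U)" "total_class ` U \<times> V \<subseteq> ?q ` W"
          using open_map_total_class by (auto simp: open_map_def image_iff) force
        then show "\<exists>U V. openin total U \<and> openin euclidean V \<and> e \<in> U \<and> c \<in> V \<and> U \<times> V \<subseteq> ?q ` W"
          using UV p by blast
      qed
    qed
    show "?q ` topspace ?Z = topspace ?S"
      by (force simp: topspace_total)
  qed
  ultimately show ?thesis
    using continuous_compose_quotient_map_eq by blast
qed

text \<open>Computation with representatives: the total class map is a homomorphism onto each fiber.\<close>

lemma fiber_operations:
  assumes x: "x \<in> topspace X"
  shows carrier_fiber: "carrier (fiber x) = (\<lambda>a. total_class (x, a)) ` nc_disk"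
    and add_fiber: "a \<in> nc_disk \<Longrightarrow> b \<in> nc_disk \<Longrightarrow>
      total_class (x, a) \<oplus>\<^bsub>fiber x\<^esub> total_class (x, b) = total_class (x, a + b)"
    and mult_fiber: "a \<in> nc_disk \<Longrightarrow> b \<in> nc_disk \<Longrightarrow>
      total_class (x, a) \<otimes>\<^bsub>fiber x\<^esub> total_class (x, b) = total_class (x, a o\<^sub>L b)"
    and smult_fiber: "a \<in> nc_disk \<Longrightarrow> c \<odot>\<^bsub>fiber x\<^esub> total_class (x, a) = total_class (x, op_scale c a)"
    and one_fiber: "\<one>\<^bsub>fiber x\<^esub> = total_class (x, id_blinfun)"
    and zero_fiber: "\<zero>\<^bsub>fiber x\<^esub> = total_class (x, 0)"
  using ideal[OF x]
  by (auto simp: fiber_def total_class_def carrier_disk_quot add_disk_quot mult_disk_quot smult_disk_quot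
      one_disk_quot zero_disk_quot)

lemma carrier_fiber_total:
  assumes "x \<in> topspace X"
  shows "carrier (fiber x) = {e \<in> topspace total. fst e = x}"
  using assms by (auto simp: carrier_fiber topspace_total)

lemma complex_algebra_fiber:
  assumes x: "x \<in> topspace X"
  shows "complex_algebra (fiber x)"
  by (rule complex_algebra_hom_image[OF complex_algebra_nc_disk, where q = "\<lambda>a. total_class (x, a)"])
     (use x in \<open>auto simp: op_algebra_def carrier_fiber add_fiber mult_fiber smult_fiber one_fiber zero_fiber\<close>)

lemma minus_fiber:
  assumes x: "x \<in> topspace X" and a: "a \<in> nc_disk" and b: "b \<in> nc_disk"
  shows "total_class (x, a) \<ominus>\<^bsub>fiber x\<^esub> total_class (x, b) = total_class (x, a - b)"
proof -
  interpret complex_algebra "fiber x" by (rule complex_algebra_fiber[OF x])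
  note in_disk = a b uminus_in_nc_disk[OF b]
  have "\<ominus>\<^bsub>fiber x\<^esub> total_class (x, b) = total_class (x, - b)"
    by (rule minus_equality) (use x in_disk in \<open>auto simp: add_fiber zero_fiber carrier_fiber\<close>)
  then show ?thesis using add_fiber[OF x, of a "- b"] in_disk by (simp add: a_minus_def)
qed

lemma seminorm_on_fiber:
  assumes x: "x \<in> topspace X"
  shows "seminorm_on (fiber x) total_norm"
  using infdist_add_le[OF subspace_if_ops_subspace[OF subspace_J[OF x]]]
    infdist_op_scale[OF subspace_J[OF x]]
  by (auto simp: seminorm_on_def carrier_fiber[OF x] add_fiber[OF x] smult_fiber[OF x]
      total_norm_class[OF x] infdist_nonneg)

lemma complete_norm_on_fiber:
  assumes x: "x \<in> topspace X"
  shows "complete_norm_on (fiber x) total_norm"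
  unfolding complete_norm_on_def
proof (intro allI impI, elim conjE)
  fix u :: "nat \<Rightarrow> 'x \<times> 'd fock_op set"
  assume u: "range u \<subseteq> carrier (fiber x)"
    and cauchy: "\<forall>\<epsilon>>0. \<exists>N. \<forall>m\<ge>N. \<forall>n\<ge>N. total_norm (u m \<ominus>\<^bsub>fiber x\<^esub> u n) < \<epsilon>"
  have "\<exists>a\<in>nc_disk. u n = total_class (x, a)" for n
    using u by (auto simp: carrier_fiber[OF x])
  then obtain a where a: "\<And>n. a n \<in> nc_disk" "\<And>n. u n = total_class (x, a n)" by metis
  have norm_diff: "total_norm (u n \<ominus>\<^bsub>fiber x\<^esub> total_class (x, b)) = infdist (a n - b) (J x)"
    if "b \<in> nc_disk" for n b
    by (simp add: a minus_fiber[OF x] that total_norm_class[OF x])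
  have "\<exists>l\<in>nc_disk. (\<lambda>n. infdist (a n - l) (J x)) \<longlonglongrightarrow> 0"
  proof (rule infdist_cauchy_limit)
    show "subspace (J x)" by (rule subspace_if_ops_subspace[OF subspace_J[OF x]])
    show "subspace (nc_disk :: 'd fock_op set)"
      by (rule subspace_if_ops_subspace)
         (auto simp: ops.subspace_def zero_in_nc_disk add_in_nc_disk scale_in_nc_disk)
    show "closed (nc_disk :: 'd fock_op set)" by (simp add: nc_disk_def)
    show "J x \<subseteq> nc_disk" by (rule disk_ideal_subset[OF ideal[OF x]])
    show "\<exists>N. \<forall>m\<ge>N. \<forall>n\<ge>N. infdist (a m - a n) (J x) < e" if "e > 0" for e
      using cauchy that norm_diff[OF a(1)] by (simp add: a(2))
  qed (rule a)
  then obtain l where l: "l \<in> nc_disk" "(\<lambda>n. infdist (a n - l) (J x)) \<longlonglongrightarrow> 0" by blast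
  then show "\<exists>l\<in>carrier (fiber x). (\<lambda>n. total_norm (u n \<ominus>\<^bsub>fiber x\<^esub> l)) \<longlonglongrightarrow> 0"
    by (intro bexI[of _ "total_class (x, l)"]) (auto simp: norm_diff carrier_fiber[OF x])
qed

lemma banach_algebra_fiber:
  assumes x: "x \<in> topspace X"
  shows "banach_algebra (fiber x) total_norm"
  unfolding banach_algebra_def
proof (intro conjI ballI impI)
  show "complex_algebra (fiber x)" by (rule complex_algebra_fiber[OF x])
  show "seminorm_on (fiber x) total_norm" by (rule seminorm_on_fiber[OF x])
  show "complete_norm_on (fiber x) total_norm" by (rule complete_norm_on_fiber[OF x])
  show "e = \<zero>\<^bsub>fiber x\<^esub>" if e: "e \<in> carrier (fiber x)" and "total_norm e = 0" for e
  proof -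
    obtain a where a: "e = total_class (x, a)" using e by (auto simp: carrier_fiber[OF x])
    have "J x \<noteq> {}" using ops.subspace_0[OF subspace_J[OF x]] by auto
    then have "a \<in> J x"
      using that(2) in_closed_iff_infdist_zero[OF closed[OF x]] by (simp add: a total_norm_class[OF x])
    then show ?thesis by (simp add: a zero_fiber[OF x] total_class_eq_iff[OF x])
  qed
  show "total_norm (e \<otimes>\<^bsub>fiber x\<^esub> e') \<le> total_norm e * total_norm e'"
    if "e \<in> carrier (fiber x)" "e' \<in> carrier (fiber x)" for e e'
    using that infdist_compose_le[OF ideal[OF x]]
    by (auto simp: carrier_fiber[OF x] mult_fiber[OF x] total_norm_class[OF x])
qed

lemma snd_isometric_iso: "isometric_iso (fiber x) total_norm (quotient_at x) quot_norm snd"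
  unfolding isometric_iso_def
  by (auto simp: fiber_def total_norm_def bij_betw_def inj_on_def image_iff intro!: ring_iso_memI)

theorem banach_algebra_bundle_total: "banach_algebra_bundle total X fst fiber total_norm"
proof (intro banach_algebra_bundle.intro lc_algebra_bundle.intro banach_algebra_bundle_axioms.intro)
  show "continuous_map total X fst" by (rule fst_continuous)
  show "open_map total X fst" by (rule fst_open)
  show "fst ` topspace total = topspace X"
    using zero_in_nc_disk by (force simp: topspace_total image_image)
  show "carrier (fiber x) = {e \<in> topspace total. fst e = x}" if "x \<in> topspace X" for x
    by (rule carrier_fiber_total[OF that])
  show "complex_algebra (fiber x)" if "x \<in> topspace X" for x
    by (rule complex_algebra_fiber[OF that])
  show "seminorm_on (fiber x) \<sigma>" if "\<sigma> \<in> {total_norm}" "x \<in> topspace X" for \<sigma> x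
    using seminorm_on_fiber that by simp
  show "\<exists>\<sigma>\<in>{total_norm}. \<exists>C>0. \<forall>e\<in>topspace total. \<sigma>1 e \<le> C * \<sigma> e \<and> \<sigma>2 e \<le> C * \<sigma> e"
    if "\<sigma>1 \<in> {total_norm}" "\<sigma>2 \<in> {total_norm}" for \<sigma>1 \<sigma>2
    using that by (intro bexI[of _ total_norm] exI[of _ 1]) auto
  show "continuous_map (subtopology (prod_topology total total) {(e, e'). fst e = fst e'}) total
      (\<lambda>(e, e'). e \<oplus>\<^bsub>fiber (fst e)\<^esub> e')"
    by (rule binop_continuous[OF continuous_map_top_of_set_binop[OF continuous_on_plus_pair]])
       (auto simp: add_in_nc_disk add_fiber)
  show "continuous_map (subtopology (prod_topology total total) {(e, e'). fst e = fst e'}) total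
      (\<lambda>(e, e'). e \<otimes>\<^bsub>fiber (fst e)\<^esub> e')"
    by (rule binop_continuous[OF continuous_map_top_of_set_binop[OF continuous_on_compose_pair]])
       (auto simp: mult_in_nc_disk mult_fiber)
  show "continuous_map (prod_topology total euclidean) total (\<lambda>(e, c). c \<odot>\<^bsub>fiber (fst e)\<^esub> e)"
    by (rule smult_total_continuous) (simp add: smult_fiber)
  show "continuous_map total euclideanreal \<sigma>" if "\<sigma> \<in> {total_norm}" for \<sigma>
    using that total_norm_continuous by simp
  show "openin total {e \<in> topspace total. fst e \<in> U \<and> \<sigma> e < \<epsilon>} \<and>
      \<zero>\<^bsub>fiber x\<^esub> \<in> {e \<in> topspace total. fst e \<in> U \<and> \<sigma> e < \<epsilon>}"
    if U: "openin X U" "x \<in> U" and \<sigma>: "\<sigma> \<in> {total_norm}" and \<epsilon>: "0 < \<epsilon>" for U x \<sigma> \<epsilon>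
  proof
    have "openin total ({e \<in> topspace total. fst e \<in> U} \<inter> {e \<in> topspace total. total_norm e \<in> {..<\<epsilon>}})"
      by (intro openin_Int openin_continuous_map_preimage[OF fst_continuous]
          openin_continuous_map_preimage[OF total_norm_continuous] U) simp
    moreover have "{e \<in> topspace total. fst e \<in> U} \<inter> {e \<in> topspace total. total_norm e \<in> {..<\<epsilon>}}
        = {e \<in> topspace total. fst e \<in> U \<and> \<sigma> e < \<epsilon>}"
      using \<sigma> by auto
    ultimately show "openin total {e \<in> topspace total. fst e \<in> U \<and> \<sigma> e < \<epsilon>}" by simp
    have x: "x \<in> topspace X" using U openin_subset by blast
    then show "\<zero>\<^bsub>fiber x\<^esub> \<in> {e \<in> topspace total. fst e \<in> U \<and> \<sigma> e < \<epsilon>}"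
      using U \<sigma> \<epsilon> zero_in_nc_disk ops.subspace_0[OF subspace_J[OF x]]
      by (auto simp: zero_fiber topspace_total total_norm_class)
  qed
  show "\<exists>U \<sigma> \<epsilon>. openin X U \<and> x \<in> U \<and> \<sigma> \<in> {total_norm} \<and> 0 < \<epsilon> \<and>
      {e \<in> topspace total. fst e \<in> U \<and> \<sigma> e < \<epsilon>} \<subseteq> W"
    if x: "x \<in> topspace X" and W: "openin total W" and zero: "\<zero>\<^bsub>fiber x\<^esub> \<in> W" for x W
  proof -
    have "openin pre_total {p \<in> topspace pre_total. total_class p \<in> W}"
      using W by (simp only: openin_total)
    moreover have "(x, 0) \<in> {p \<in> topspace pre_total. total_class p \<in> W}"
      using x zero zero_in_nc_disk by (simp add: zero_fiber)
    ultimately obtain U V where U: "openin X U" "x \<in> U" and V: "openin (top_of_set nc_disk) V" "0 \<in> V"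
      and UV: "U \<times> V \<subseteq> {p \<in> topspace pre_total. total_class p \<in> W}"
      unfolding openin_prod_topology_alt by meson
    \<comment> \<open>An element of fiber norm less than \<open>\<epsilon>\<close> has a representative in this ball.\<close>
    obtain \<epsilon> where \<epsilon>: "\<epsilon> > 0" "ball 0 \<epsilon> \<inter> nc_disk \<subseteq> V"
      using V by (auto simp: openin_contains_ball)
    have "e \<in> W" if e: "e \<in> topspace total" "fst e \<in> U" "total_norm e < \<epsilon>" for e
    proof -
      obtain y a where y: "y \<in> topspace X" and a: "a \<in> nc_disk" "e = total_class (y, a)"
        using e by (auto simp: topspace_total)
      have "infdist a (J y) < \<epsilon>" using e a total_norm_class[OF y] by simp
      moreover have "J y \<noteq> {}" using ops.subspace_0[OF subspace_J[OF y]] by auto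
      ultimately obtain j where j: "j \<in> J y" "dist a j < \<epsilon>"
        using infdist_approx[of "J y" "\<epsilon> - infdist a (J y)" a] by auto
      then have "a - j \<in> V"
        using \<epsilon> a disk_ideal_subset[OF ideal[OF y]]
        by (auto simp: dist_norm norm_minus_commute intro!: diff_in_nc_disk subsetD[OF \<epsilon>(2)])
      then have "total_class (y, a - j) \<in> W" using UV e a by auto
      moreover have "total_class (y, a - j) = e"
        using j ops.subspace_neg[OF subspace_J[OF y]] by (simp add: a total_class_eq_iff[OF y])
      ultimately show ?thesis by simp
    qed
    then show ?thesis using U \<epsilon> by (intro exI[of _ U] exI[of _ total_norm] exI[of _ \<epsilon>]) auto
  qed
  show "banach_algebra (fiber x) total_norm" if "x \<in> topspace X" for x
    by (rule banach_algebra_fiber[OF that])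
qed

end

section \<open>Continuity in the ideal, and the bundle over a family of projections\<close>

text \<open>The comparison of two ideals applies to polynomials; as \<open>infdist\<close> is 1-Lipschitz in its
  first argument, it extends to the closure. The comparison is symmetric in the two ideals, which
  gives both semicontinuities at once.\<close>

lemma infdist_ideal_continuous:
  fixes X :: "'x topology"
    and \<phi> :: "'x \<Rightarrow> 'd::finite fock_op"
    and I :: "'x \<Rightarrow> 'd fock_op set"
  assumes \<phi>: "continuous_map X strong_operator_topology \<phi>"
    and I: "\<And>x. x \<in> topspace X \<Longrightarrow> graded_ideal (I x)"
    and P: "\<And>x. x \<in> topspace X \<Longrightarrow> ideal_projection (I x) (\<phi> x)"
    and a: "a \<in> nc_disk"
  shows "continuous_map X euclideanreal (\<lambda>x. infdist a (I x))"
proof (rule continuous_map_realI)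
  fix x and e :: real assume x: "x \<in> topspace X" and e: "e > 0"
  obtain p where p: "p \<in> nc_polys" "dist p a < e / 4"
    using a e unfolding nc_disk_def closure_approachable by (meson divide_pos_pos zero_less_numeral)
  have "e / 4 > 0" using e by simp
  from infdist_ideal_compare[OF p(1) this]
  obtain F :: "'d fock set" and d where F: "finite F" "d > 0"
    and compare: "\<And>I J P Q. \<lbrakk>graded_ideal I; ideal_projection I P; graded_ideal J; ideal_projection J Q;
        \<And>\<xi>. \<xi> \<in> F \<Longrightarrow> norm (blinfun_apply P \<xi> - blinfun_apply Q \<xi>) \<le> d\<rbrakk>
      \<Longrightarrow> infdist p I \<le> infdist p J + e / 4"
    by metis
  define U where "U = {y \<in> topspace X. \<phi> y \<in> {A. \<forall>\<xi>\<in>F. blinfun_apply A \<xi> \<in> ball (blinfun_apply (\<phi> x) \<xi>) d}}"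
  have U: "openin X U"
    unfolding U_def
    by (rule openin_continuous_map_preimage[OF \<phi>])
       (rule strong_operator_topology_basis[where x = "\<lambda>\<xi>. \<xi>", OF F(1)], simp)
  have xU: "x \<in> U" using x F by (simp add: U_def)
  have "\<bar>infdist a (I y) - infdist a (I x)\<bar> < e" if y: "y \<in> U" for y
  proof -
    have yX: "y \<in> topspace X"
      and close: "\<And>\<xi>. \<xi> \<in> F \<Longrightarrow> norm (blinfun_apply (\<phi> x) \<xi> - blinfun_apply (\<phi> y) \<xi>) \<le> d"
      using y by (auto simp: U_def dist_norm less_imp_le)
    have "infdist p (I x) \<le> infdist p (I y) + e / 4"
      by (rule compare[OF I P I P]) (use x yX close in auto)
    moreover have "infdist p (I y) \<le> infdist p (I x) + e / 4"
      by (rule compare[OF I P I P]) (use x yX close in \<open>auto simp: norm_minus_commute\<close>)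
    ultimately show ?thesis
      using p(2) infdist_triangle_abs[of p "I x" a] infdist_triangle_abs[of p "I y" a] by linarith
  qed
  then show "\<exists>U. openin X U \<and> x \<in> U \<and> (\<forall>y\<in>U. \<bar>infdist a (I y) - infdist a (I x)\<bar> < e)"
    using U xU by blast
qed

theorem theorem4:
  fixes X :: "'x topology"
    and \<phi> :: "'x \<Rightarrow> 'd::finite fock_op"
    and I :: "'x \<Rightarrow> 'd fock_op set"
  assumes "continuous_map X ideal_space \<phi>"
    and "\<And>x. x \<in> topspace X \<Longrightarrow> graded_ideal (I x) \<and> ideal_projection (I x) (\<phi> x)"
  shows "\<exists>(E :: ('x \<times> 'd fock_op set) topology) \<pi> F \<nu>.
           banach_algebra_bundle E X \<pi> F \<nu> \<and>
           (\<forall>x\<in>topspace X. \<exists>h. isometric_iso (F x) \<nu> (disk_quotient (I x)) quot_norm h)"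
proof -
  have \<phi>: "continuous_map X strong_operator_topology \<phi>"
    using assms(1) by (simp add: ideal_space_def continuous_map_in_subtopology)
  interpret disk_ideal_field X "\<lambda>x. closure (I x)"
  proof (rule disk_ideal_field.intro)
    fix x assume "x \<in> topspace X"
    then show "ideal (closure (I x)) (op_algebra nc_disk)"
      using assms(2) closure_graded_ideal by blast
  next
    fix a :: "'d fock_op" assume "a \<in> nc_disk"
    then show "continuous_map X euclideanreal (\<lambda>x. infdist a (closure (I x)))"
      unfolding infdist_closure using assms(2) by (intro infdist_ideal_continuous[OF \<phi>]) auto
  qed simp
  show ?thesis
    using banach_algebra_bundle_total snd_isometric_iso unfolding disk_quotient_def by blast
qed

end
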